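(* Let $\mathcal H$ be a complex, separable Hilbert space with norm $\|\cdot\|_{\mathcal H}$. Let $\ell,m,N\in\mathbb N$ with $1\le \ell\le m$, let $\alpha\in\mathbb R$, and let $\rho,\gamma,\tau\in(0,\infty)$. Let $A$, $B$, $c_{2j}$, $\ln_p$, $L_p$, $e_N$ be as in the context. Then the following hold. (i) If $\rho\ge e_N\gamma$, then for all $f\in C_0^\infty((\rho,\infty);\mathcal H)$, \begin{align*} \int_\rho^\infty x^\alpha \|f^{(m)}(x)\|_{\mathcal H}^2dx \ge{}& A(\ell,\alpha)\int_\rho^\infty x^{\alpha-2\ell}\|f^{(m-\ell)}(x)\|_{\mathcal H}^2dx\\ &+B(\ell,\alpha)\sum_{k=1}^{N}\int_\rho^\infty x^{\alpha-2\ell}\prod_{p=1}^k[\ln_p(x/\gamma)]^{-2}\|f^{(m-\ell)}(x)\|_{\mathcal H}^2dx\\ &+\sum_{j=2}^{\ell}|c_{2j}(\ell,\alpha)|A(j,0)\int_\rho^\infty x^{\alpha-2\ell}[\ln(x/\gamma)]^{-2j}\|f^{(m-\ell)}(x)\|_{\mathcal H}^2dx\\ &+\sum_{j=2}^{\ell}|c_{2j}(\ell,\alpha)|B(j,0)\sum_{k=1}^{N-1}\int_\rho^\infty x^{\alpha-2\ell}[\ln(x/\gamma)]^{-2j}\prod_{p=1}^k[\ln_{p+1}(x/\gamma)]^{-2}\|f^{(m-\ell)}(x)\|_{\mathcal H}^2dx. \end{align*} (ii) If $\rho\ge\tau$, then for all $f\in C_0^\infty((\rho,\infty);\mathcal H)$,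 \begin{align*} \int_\rho^\infty x^\alpha \|f^{(m)}(x)\|_{\mathcal H}^2dx \ge{}& A(\ell,\alpha)\int_\rho^\infty x^{\alpha-2\ell}\|f^{(m-\ell)}(x)\|_{\mathcal H}^2dx\\ &+B(\ell,\alpha)\sum_{k=1}^{N}\int_\rho^\infty x^{\alpha-2\ell}\prod_{p=1}^k[L_p(\tau/x)]^{2}\|f^{(m-\ell)}(x)\|_{\mathcal H}^2dx\\ &+\sum_{j=2}^{\ell}|c_{2j}(\ell,\alpha)|A(j,0)\int_\rho^\infty x^{\alpha-2\ell}[L_1(\tau/x)]^{2j}\|f^{(m-\ell)}(x)\|_{\mathcal H}^2dx\\ &+\sum_{j=2}^{\ell}|c_{2j}(\ell,\alpha)|B(j,0)\sum_{k=1}^{N-1}\int_\rho^\infty x^{\alpha-2\ell}[L_1(\tau/x)]^{2j}\prod_{p=1}^k[L_{p+1}(\tau/x)]^{2}\|f^{(m-\ell)}(x)\|_{\mathcal H}^2dx. \end{align*} (iii) If $\gamma\ge e_N\rho$, then for all $f\in C_0^\infty((0,\rho);\mathcal H)$, \begin{align*} \int_0^\rho x^\alpha \|f^{(m)}(x)\|_{\mathcal H}^2dx \ge{}& A(\ell,\alpha)\int_0^\rho x^{\alpha-2\ell}\|f^{(m-\ell)}(x)\|_{\mathcal H}^2dx\\ &+B(\ell,\alpha)\sum_{k=1}^{N}\int_0^\rho x^{\alpha-2\ell}\prod_{p=1}^k[\ln_p(\gamma/x)]^{-2}\|f^{(m-\ell)}(x)\|_{\mathcal H}^2dx\\ &+\sum_{j=2}^{\ell}|c_{2j}(\ell,\alpha)|A(j,0)\int_0^\rho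 x^{\alpha-2\ell}[\ln(\gamma/x)]^{-2j}\|f^{(m-\ell)}(x)\|_{\mathcal H}^2dx\\ &+\sum_{j=2}^{\ell}|c_{2j}(\ell,\alpha)|B(j,0)\sum_{k=1}^{N-1}\int_0^\rho x^{\alpha-2\ell}[\ln(\gamma/x)]^{-2j}\prod_{p=1}^k[\ln_{p+1}(\gamma/x)]^{-2}\|f^{(m-\ell)}(x)\|_{\mathcal H}^2dx. \end{align*} (iv) If $\tau\ge\rho$, then for all $f\in C_0^\infty((0,\rho);\mathcal H)$, \begin{align*} \int_0^\rho x^\alpha \|f^{(m)}(x)\|_{\mathcal H}^2dx \ge{}& A(\ell,\alpha)\int_0^\rho x^{\alpha-2\ell}\|f^{(m-\ell)}(x)\|_{\mathcal H}^2dx\\ &+B(\ell,\alpha)\sum_{k=1}^{N}\int_0^\rho x^{\alpha-2\ell}\prod_{p=1}^k[L_p(x/\tau)]^{2}\|f^{(m-\ell)}(x)\|_{\mathcal H}^2dx\\ &+\sum_{j=2}^{\ell}|c_{2j}(\ell,\alpha)|A(j,0)\int_0^\rho x^{\alpha-2\ell}[L_1(x/\tau)]^{2j}\|f^{(m-\ell)}(x)\|_{\mathcal H}^2dx\\ &+\sum_{j=2}^{\ell}|c_{2j}(\ell,\alpha)|B(j,0)\sum_{k=1}^{N-1}\int_0^\rho x^{\alpha-2\ell}[L_1(x/\tau)]^{2j}\prod_{p=1}^k[L_{p+1}(x/\tau)]^{2}\|f^{(m-\ell)}(x)\|_{\mathcal H}^2dx. \end{align*} (v) Each of the inequalities in (i)--(iv)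 is strict whenever $f\not\equiv0$ (on $(\rho,\infty)$, respectively $(0,\rho)$). (vi) In the exceptional cases $\alpha\in\{2j-1\}_{1\le j\le \ell}$ (i.e., if and only if $A(\ell,\alpha)=0$), the first terms, containing $A(\ell,\alpha)$, on the right-hand sides are to be deleted (the inequalities hold without them).
   Context: $\mathbb N=\{1,2,\dots\}$; $C_0^\infty((a,b);\mathcal H)$ denotes the (norm-)smooth $\mathcal H$-valued functions with compact support in the open interval $(a,b)$. Empty sums ($\sum_{k=1}^{0}$, $\sum_{j=2}^{1}$) are $0$. Iterated logarithms: $\ln_1=\ln$, $\ln_{j+1}(\cdot)=\ln(\ln_j(\cdot))$, $j\in\mathbb N$. Normalized iterated logarithms: $L_1(s)=(1-\ln s)^{-1}$ and $L_{j+1}(s)=L_1(L_j(s))$, $j\in\mathbb N$, for $s\in(0,1]$. Iterated exponentials: $e_0=0$, $e_{j+1}=e^{e_j}$, $j\in\mathbb N\cup\{0\}$ (so $e_1=1$, $e_2=e$). Constants: for $m\in\mathbb N$, $\alpha\in\mathbb R$, $$A(m,\alpha)=\prod_{j=1}^m\Big(\frac{2j-1-\alpha}{2}\Big)^2,\qquad B(m,\alpha)=\frac1{4^m}\sum_{k=1}^m\prod_{\substack{j=1\\ j\ne k}}^m(2j-1-\alpha)^2,$$ and $c_i(m,\alpha)$, $0\le i\le 2m$, are the coefficients of the polynomial $$\sum_{i=0}^{2m}c_i(m,\alpha)\lambda^i=\prod_{j=1}^m\Big(\lambda^2-\frac{(2j-1-\alpha)^2}{4}\Big).$$ *)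

theory Defs
  imports "HOL-Analysis.Analysis" "HOL-Computational_Algebra.Polynomial"
begin

text \<open>Complex Hilbert spaces. The inner product is linear in its first argument; the real scalar
  multiplication, the norm and the topology inherited from \<^class>\<open>real_normed_vector\<close> are tied to
  the complex structure by \<open>scaleR_eq_scaleC\<close> and \<open>norm_eq_sqrt_cinner\<close>.\<close>

class complex_inner_space = real_normed_vector +
  fixes scaleC :: "complex \<Rightarrow> 'a \<Rightarrow> 'a"
    and cinner :: "'a \<Rightarrow> 'a \<Rightarrow> complex"
  assumes scaleC_add_right: "scaleC a (x + y) = scaleC a x + scaleC a y"
    and scaleC_add_left: "scaleC (a + b) x = scaleC a x + scaleC b x"
    and scaleC_scaleC: "scaleC a (scaleC b x) = scaleC (a * b) x"
    and scaleC_one: "scaleC 1 x = x"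
    and scaleR_eq_scaleC: "scaleR r x = scaleC (complex_of_real r) x"
    and cinner_commute: "cinner x y = cnj (cinner y x)"
    and cinner_add_left: "cinner (x + y) z = cinner x z + cinner y z"
    and cinner_scaleC_left: "cinner (scaleC a x) y = a * cinner x y"
    and cinner_nonneg: "0 \<le> Re (cinner x x)"
    and cinner_eq_zero_iff: "cinner x x = 0 \<longleftrightarrow> x = 0"
    and norm_eq_sqrt_cinner: "norm x = sqrt (Re (cinner x x))"

class complex_hilbert_space = complex_inner_space + complete_space

instantiation complex :: complex_hilbert_space
begin

definition scaleC_complex :: "complex \<Rightarrow> complex \<Rightarrow> complex" where
  "scaleC_complex a x = a * x"

definition cinner_complex :: "complex \<Rightarrow> complex \<Rightarrow> complex" where
  "cinner_complex x y = x * cnj y"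

instance
  by intro_classes
    (auto simp: scaleC_complex_def cinner_complex_def algebra_simps scaleR_conv_of_real
      cmod_def power2_eq_square)

end


text \<open>For an open set \<open>S\<close>, the following notions depend only on the values of \<open>f\<close> on \<open>S\<close>; what
  \<open>f\<close> does outside \<open>S\<close> is irrelevant, so they express functions defined on \<open>S\<close>.\<close>

definition nth_deriv :: "nat \<Rightarrow> (real \<Rightarrow> 'a::real_normed_vector) \<Rightarrow> real \<Rightarrow> 'a" where
  "nth_deriv k f = ((\<lambda>g x. vector_derivative g (at x)) ^^ k) f"

definition test_functions :: "real set \<Rightarrow> (real \<Rightarrow> 'a::real_normed_vector) set" where
  "test_functions S =
     {f. (\<forall>k. \<forall>x\<in>S. nth_deriv k f differentiable (at x)) \<and>
         compact (closure {x\<in>S. f x \<noteq> 0}) \<and> closure {x\<in>S. f x \<noteq> 0} \<subseteq> S}"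


text \<open>The index \<open>0\<close> gives the identity; the indices of interest are \<open>j \<ge> 1\<close>.\<close>

definition iter_ln :: "nat \<Rightarrow> real \<Rightarrow> real" where
  "iter_ln j = (ln ^^ j)"

definition norm_iter_ln :: "nat \<Rightarrow> real \<Rightarrow> real" where
  "norm_iter_ln j = ((\<lambda>s. inverse (1 - ln s)) ^^ j)"

definition iter_exp :: "nat \<Rightarrow> real" where
  "iter_exp j = (exp ^^ j) 0"

definition A_const :: "nat \<Rightarrow> real \<Rightarrow> real" where
  "A_const m \<alpha> = (\<Prod>j=1..m. ((2 * real j - 1 - \<alpha>) / 2)\<^sup>2)"

definition B_const :: "nat \<Rightarrow> real \<Rightarrow> real" where
  "B_const m \<alpha> = 1 / 4 ^ m * (\<Sum>k=1..m. \<Prod>j\<in>{1..m} - {k}. (2 * real j - 1 - \<alpha>)\<^sup>2)"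

definition c_const :: "nat \<Rightarrow> nat \<Rightarrow> real \<Rightarrow> real" where
  "c_const i m \<alpha> = coeff (\<Prod>j=1..m. monom 1 2 - [:(2 * real j - 1 - \<alpha>)\<^sup>2 / 4:]) i"


definition weighted_int :: "real set \<Rightarrow> real \<Rightarrow> (real \<Rightarrow> real) \<Rightarrow> (real \<Rightarrow> 'a::real_normed_vector) \<Rightarrow> real" where
  "weighted_int S \<beta> w g = (LBINT x:S. x powr \<beta> * w x * (norm (g x))\<^sup>2)"

text \<open>The logarithmic terms on the right-hand side of the four inequalities, where \<open>g\<close> stands for
  \<open>f\<^sup>(\<^sup>m\<^sup>-\<^sup>\<ell>\<^sup>)\<close> and \<open>W p x\<close> is one of the factors
  \<open>[ln\<^sub>p(x/\<gamma>)]\<^sup>-\<^sup>1\<close>, \<open>L\<^sub>p(\<tau>/x)\<close>, \<open>[ln\<^sub>p(\<gamma>/x)]\<^sup>-\<^sup>1\<close>, \<open>L\<^sub>p(x/\<tau>)\<close>.\<close>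

definition log_terms ::
  "real set \<Rightarrow> nat \<Rightarrow> nat \<Rightarrow> real \<Rightarrow> (nat \<Rightarrow> real \<Rightarrow> real) \<Rightarrow> (real \<Rightarrow> 'a::real_normed_vector) \<Rightarrow> real" where
  "log_terms S l N \<alpha> W g =
     B_const l \<alpha> * (\<Sum>k=1..N. weighted_int S (\<alpha> - 2 * real l) (\<lambda>x. \<Prod>p=1..k. (W p x)\<^sup>2) g)
   + (\<Sum>j=2..l. \<bar>c_const (2 * j) l \<alpha>\<bar> * A_const j 0 *
        weighted_int S (\<alpha> - 2 * real l) (\<lambda>x. W 1 x ^ (2 * j)) g)
   + (\<Sum>j=2..l. \<bar>c_const (2 * j) l \<alpha>\<bar> * B_const j 0 *
        (\<Sum>k=1..N - 1. weighted_int S (\<alpha> - 2 * real l)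
           (\<lambda>x. W 1 x ^ (2 * j) * (\<Prod>p=1..k. (W (p + 1) x)\<^sup>2)) g))"

text \<open>The inequality for a single \<open>f\<close>, together with its strictness when \<open>f\<close> does not vanish
  identically on \<open>S\<close>, and its variant without the \<open>A\<close>-term.\<close>

definition hardy_ineq ::
  "real set \<Rightarrow> nat \<Rightarrow> nat \<Rightarrow> nat \<Rightarrow> real \<Rightarrow> (nat \<Rightarrow> real \<Rightarrow> real) \<Rightarrow> (real \<Rightarrow> 'a::real_normed_vector) \<Rightarrow> bool" where
  "hardy_ineq S l m N \<alpha> W f \<longleftrightarrow>
     (let lhs = weighted_int S \<alpha> (\<lambda>x. 1) (nth_deriv m f);
          rhs = A_const l \<alpha> * weighted_int S (\<alpha> - 2 * real l) (\<lambda>x. 1) (nth_deriv (m - l) f)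
                + log_terms S l N \<alpha> W (nth_deriv (m - l) f)
      in lhs \<ge> rhs \<and> ((\<exists>x\<in>S. f x \<noteq> 0) \<longrightarrow> lhs > rhs))"

definition hardy_ineq_without_A ::
  "real set \<Rightarrow> nat \<Rightarrow> nat \<Rightarrow> nat \<Rightarrow> real \<Rightarrow> (nat \<Rightarrow> real \<Rightarrow> real) \<Rightarrow> (real \<Rightarrow> 'a::real_normed_vector) \<Rightarrow> bool" where
  "hardy_ineq_without_A S l m N \<alpha> W f \<longleftrightarrow>
     (let lhs = weighted_int S \<alpha> (\<lambda>x. 1) (nth_deriv m f);
          rhs = log_terms S l N \<alpha> W (nth_deriv (m - l) f)
      in lhs \<ge> rhs \<and> ((\<exists>x\<in>S. f x \<noteq> 0) \<longrightarrow> lhs > rhs))"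

end

theory Submission
  imports Defs
begin

text \<open>With \<open>t = \<plusminus>ln x + d\<close> and \<open>f\<^sup>(\<^sup>m\<^sup>-\<^sup>l\<^sup>)(x) = x powr \<beta> * u(t)\<close>, \<open>\<beta> = (2l - 1 - \<alpha>) / 2\<close>, the left-hand side
  becomes \<open>\<integral>\<parallel>P(d/dt) u\<parallel>\<^sup>2 dt\<close> with \<open>P(\<lambda>) = \<Prod>j=1..l. (\<plusminus>\<lambda> + (2j - 1 - \<alpha>) / 2)\<close>. Cross terms integrate to
  zero, so this equals \<open>\<Sum>i\<le>l. \<bar>c_const (2i) l \<alpha>\<bar> * \<integral>\<parallel>u\<^sup>(\<^sup>i\<^sup>)\<parallel>\<^sup>2 dt\<close>, where the coefficients for \<open>i = 0\<close> and
  \<open>i = 1\<close> are \<open>A_const l \<alpha>\<close> and \<open>4 * B_const l \<alpha>\<close>. Since \<open>\<plusminus>ln x + d\<close> shifts the iterated logarithms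
  by one index, each integral with \<open>i \<ge> 1\<close> is estimated by the same inequality for \<open>\<alpha> = 0\<close> on a half-line
  with one logarithm fewer, keeping only its \<open>A\<close>- and \<open>B\<close>-terms; the theorem follows by induction on \<open>N\<close>.
  Strictness comes from the term \<open>i = l\<close>, whose coefficient is 1.\<close>

subsection \<open>Derivative chains and the energy identity\<close>

text \<open>The real part suffices: it already determines the norm, and its symmetry lets the two
  halves of a cross term be merged.\<close>

definition rinner :: "'a::complex_inner_space \<Rightarrow> 'a \<Rightarrow> real" where
  "rinner x y = Re (cinner x y)"

lemma norm_sq_rinner: "(norm x)\<^sup>2 = rinner x x"
  by (simp add: norm_eq_sqrt_cinner cinner_nonneg rinner_def)

lemma rinner_commute: "rinner x y = rinner y x"
  unfolding rinner_def by (subst cinner_commute) simp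

lemma rinner_add_left: "rinner (x + y) z = rinner x z + rinner y z"
  by (simp add: rinner_def cinner_add_left)

lemma rinner_scaleR_left: "rinner (r *\<^sub>R x) y = r * rinner x y"
  by (simp add: rinner_def scaleR_eq_scaleC cinner_scaleC_left)

lemma rinner_add_right: "rinner z (x + y) = rinner z x + rinner z y"
  by (metis rinner_add_left rinner_commute)

lemma rinner_scaleR_right: "rinner y (r *\<^sub>R x) = r * rinner y x"
  by (metis rinner_scaleR_left rinner_commute)

text \<open>Cauchy-Schwarz follows from the triangle inequality, which the class provides, by
  comparing squares.\<close>

lemma rinner_le_norm: "rinner x y \<le> norm x * norm y"
proof -
  have "(norm (x + y))\<^sup>2 \<le> (norm x + norm y)\<^sup>2"
    by (simp add: norm_triangle_ineq power_mono)
  moreover have "(norm (x + y))\<^sup>2 = (norm x)\<^sup>2 + 2 * rinner x y + (norm y)\<^sup>2"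
    by (simp add: norm_sq_rinner rinner_add_left rinner_add_right rinner_commute[of y x])
  ultimately show ?thesis
    by (simp add: power2_sum)
qed

lemma bounded_bilinear_rinner: "bounded_bilinear rinner"
proof
  show "\<exists>K. \<forall>a b::'a. norm (rinner a b) \<le> norm a * norm b * K"
  proof (intro exI[of _ 1] allI)
    fix a b :: 'a
    have "rinner (- a) b = - rinner a b"
      using rinner_scaleR_left[of "-1" a b] by simp
    then show "norm (rinner a b) \<le> norm a * norm b * 1"
      using rinner_le_norm[of a b] rinner_le_norm[of "- a" b] by simp
  qed
qed (simp_all add: rinner_add_left rinner_add_right rinner_scaleR_left rinner_scaleR_right)

text \<open>The successive derivatives of a smooth function on the line supported in \<open>[a, b]\<close>.\<close>

definition smooth_chain :: "real \<Rightarrow> real \<Rightarrow> (nat \<Rightarrow> real \<Rightarrow> 'a::real_normed_vector) \<Rightarrow> bool" where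
  "smooth_chain a b F \<longleftrightarrow>
     (\<forall>k x. (F k has_vector_derivative F (Suc k) x) (at x)) \<and> (\<forall>k x. x \<notin> {a..b} \<longrightarrow> F k x = 0)"

lemma smooth_chain_deriv:
  "smooth_chain a b F \<Longrightarrow> (F k has_vector_derivative F (Suc k) x) (at x within S)"
  by (auto simp: smooth_chain_def intro: has_vector_derivative_at_within)

lemma smooth_chain_outside: "smooth_chain a b F \<Longrightarrow> x \<notin> {a..b} \<Longrightarrow> F k x = 0"
  by (auto simp: smooth_chain_def)

lemma smooth_chain_continuous: "smooth_chain a b F \<Longrightarrow> continuous_on S (F k)"
  by (meson continuous_on_vector_derivative smooth_chain_deriv)

text \<open>The zero set of \<open>F k\<close> is closed and contains \<open>{..<a}\<close> and
  \<open>{b<..}\<close>, hence their endpoints. This removes the boundary terms in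
  \<open>energy_step\<close>.\<close>

lemma smooth_chain_boundary:
  assumes "smooth_chain a b F"
  shows "F k a = 0" "F k b = 0"
proof -
  have cl: "closed {x. F k x = 0}"
    using smooth_chain_continuous[OF assms] by (intro closed_Collect_eq) auto
  have "{..<a} \<subseteq> {x. F k x = 0}" "{b<..} \<subseteq> {x. F k x = 0}"
    using smooth_chain_outside[OF assms] by auto
  then have "closure {..<a} \<subseteq> {x. F k x = 0}" "closure {b<..} \<subseteq> {x. F k x = 0}"
    using cl by (metis closure_minimal)+
  then show "F k a = 0" "F k b = 0" by auto
qed

lemma smooth_chain_shift: "smooth_chain a b F \<Longrightarrow> smooth_chain a b (\<lambda>k. F (k + j))"
  by (auto simp: smooth_chain_def)

lemma smooth_chain_zero_up:
  assumes F: "smooth_chain a b F" and z: "\<And>x. F 0 x = 0"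
  shows "F k x = 0"
proof (induction k arbitrary: x)
  case (Suc k)
  have "(F k has_vector_derivative 0) (at x)"
    using Suc.IH by (simp add: fun_eq_iff[of "F k" "\<lambda>_. 0", THEN iffD2])
  then show ?case
    using smooth_chain_deriv[OF F, of k x UNIV] vector_derivative_unique_at by auto
qed (rule z)

text \<open>A vanishing derivative makes \<open>F k\<close> constant, and the bounded support makes
  the constant zero. So a function that is not identically zero has no identically vanishing
  derivative.\<close>

lemma smooth_chain_zero_down:
  assumes F: "smooth_chain a b F" and z: "\<And>x. F k x = 0"
  shows "F 0 x = 0"
  using z
proof (induction k arbitrary: x)
  case (Suc k)
  have "(F k has_vector_derivative 0) (at y within UNIV)" for y
    using smooth_chain_deriv[OF F, of k y UNIV] Suc.prems by simp
  then obtain c where c: "\<And>y. F k y = c"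
    using has_vector_derivative_zero_constant[of UNIV "F k"] by auto
  have "F k (b + 1) = 0"
    using smooth_chain_outside[OF F] by auto
  then show ?case
    using Suc.IH c by auto
qed auto

lemma energy_pos:
  assumes F: "smooth_chain a b F" and nz: "F 0 x0 \<noteq> 0"
  shows "integral {a..b} (\<lambda>x. (norm (F k x))\<^sup>2) > 0"
proof -
  have cont: "continuous_on {a..b} (\<lambda>x. (norm (F k x))\<^sup>2)"
    by (intro continuous_intros smooth_chain_continuous[OF F])
  \<comment> \<open>The nonzero value at \<open>x0\<close> excludes a degenerate interval, on which
    a zero integral would say nothing about the integrand.\<close>
  have "a \<le> x0" "x0 \<le> b" "x0 \<noteq> a"
    using nz smooth_chain_outside[OF F] smooth_chain_boundary[OF F] by force+
  then have ab: "a < b" by simp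
  have "integral {a..b} (\<lambda>x. (norm (F k x))\<^sup>2) \<noteq> 0"
  proof
    assume "integral {a..b} (\<lambda>x. (norm (F k x))\<^sup>2) = 0"
    then have "\<And>x. x \<in> {a..b} \<Longrightarrow> F k x = 0"
      using integral_eq_0_iff[OF cont ab] by auto
    then show False
      using smooth_chain_zero_down[OF F, of k] smooth_chain_outside[OF F] nz by metis
  qed
  moreover have "integral {a..b} (\<lambda>x. (norm (F k x))\<^sup>2) \<ge> 0"
    by (intro integral_nonneg integrable_continuous_real cont) auto
  ultimately show ?thesis by simp
qed

text \<open>The cross term is the derivative of a multiple of \<open>\<parallel>v\<parallel>\<^sup>2\<close> and integrates to zero.\<close>

lemma energy_step:
  fixes v :: "nat \<Rightarrow> real \<Rightarrow> 'a::complex_inner_space"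
  assumes F: "smooth_chain a b v" and s: "s\<^sup>2 = 1"
  shows "integral {a..b} (\<lambda>t. (norm (s *\<^sub>R v (Suc q) t + r *\<^sub>R v q t))\<^sup>2) =
         integral {a..b} (\<lambda>t. (norm (v (Suc q) t))\<^sup>2) + r\<^sup>2 * integral {a..b} (\<lambda>t. (norm (v q t))\<^sup>2)"
proof (cases "a \<le> b")
  case ab: True
  interpret bounded_bilinear "rinner :: 'a \<Rightarrow> 'a \<Rightarrow> real" by (rule bounded_bilinear_rinner)
  note [continuous_intros] = smooth_chain_continuous[OF F]
  let ?g = "\<lambda>t. rinner (v q t) (v (Suc q) t) + rinner (v (Suc q) t) (v q t)"
  have "(?g has_integral rinner (v q b) (v q b) - rinner (v q a) (v q a)) {a..b}"
    by (intro fundamental_theorem_of_calculus ab has_vector_derivative smooth_chain_deriv[OF F])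
  then have g: "(?g has_integral 0) {a..b}"
    by (simp add: smooth_chain_boundary[OF F] zero_left)
  have i: "((\<lambda>t. (norm (v k t))\<^sup>2) has_integral integral {a..b} (\<lambda>t. (norm (v k t))\<^sup>2)) {a..b}" for k
    by (intro integrable_integral integrable_continuous_real continuous_intros)
  have "(norm (s *\<^sub>R v (Suc q) t + r *\<^sub>R v q t))\<^sup>2 =
        (norm (v (Suc q) t))\<^sup>2 + r\<^sup>2 * (norm (v q t))\<^sup>2 + (s * r) * ?g t" for t
    unfolding norm_sq_rinner add_left add_right scaleR_left scaleR_right
    using s rinner_commute[of "v q t" "v (Suc q) t"] by (simp add: power2_eq_square algebra_simps)
  moreover have "((\<lambda>t. (norm (v (Suc q) t))\<^sup>2 + r\<^sup>2 * (norm (v q t))\<^sup>2 + (s * r) * ?g t) has_integral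
      integral {a..b} (\<lambda>t. (norm (v (Suc q) t))\<^sup>2) + r\<^sup>2 * integral {a..b} (\<lambda>t. (norm (v q t))\<^sup>2)
       + (s * r) * 0) {a..b}"
    by (intro has_integral_add has_integral_mult_right i g)
  ultimately show ?thesis
    by (simp add: integral_unique)
qed simp

lemma coeff_linear_mult_0: "coeff (P * [:a, 1:]) 0 = a * coeff P 0"
  by simp

lemma coeff_linear_mult_Suc:
  "coeff (P * [:a, 1:]) (Suc i) = coeff P i + a * coeff P (Suc i)" for a :: "'a::comm_ring_1"
  by simp

lemma degree_prod_linear_le: "degree (\<Prod>k<n. [:a k, 1:]) \<le> n" for a :: "nat \<Rightarrow> 'a::comm_ring_1"
proof -
  have "degree (\<Prod>k<n. [:a k, 1:]) \<le> (\<Sum>k<n. degree [:a k, 1:])"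
    using degree_prod_sum_le[of "{..<n}" "\<lambda>k. [:a k, 1:]"] by (simp add: o_def)
  also have "\<dots> \<le> n"
    by simp
  finally show ?thesis .
qed

text \<open>Passing from \<open>n\<close> to \<open>Suc n\<close> replaces the energy of order
  \<open>q\<close> by that of order \<open>Suc q\<close> plus \<open>(r n)\<^sup>2\<close> times
  itself; on coefficients this is multiplication by \<open>[:(r n)\<^sup>2, 1:]\<close>. The order
  \<open>q\<close> is kept general because the step raises it.\<close>

lemma energy_expansion:
  fixes V :: "nat \<Rightarrow> nat \<Rightarrow> real \<Rightarrow> 'a::complex_inner_space"
  assumes V: "\<And>n. smooth_chain a b (V n)" and s: "s\<^sup>2 = 1"
    and rec: "\<And>n q t. V (Suc n) q t = s *\<^sub>R V n (Suc q) t + r n *\<^sub>R V n q t"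
  shows "integral {a..b} (\<lambda>t. (norm (V n q t))\<^sup>2) =
    (\<Sum>i\<le>n. coeff (\<Prod>k<n. [:(r k)\<^sup>2, 1:]) i * integral {a..b} (\<lambda>t. (norm (V 0 (i + q) t))\<^sup>2))"
proof (induction n arbitrary: q)
  case (Suc n)
  let ?Q = "\<Prod>k<n. [:(r k)\<^sup>2, 1:]"
  let ?I = "\<lambda>q. integral {a..b} (\<lambda>t. (norm (V 0 q t))\<^sup>2)"
  \<comment> \<open>The degree is at most \<open>n\<close>, so the second sum may be extended by one
    index and then lines up with the shifted one.\<close>
  have top: "coeff ?Q (Suc n) = 0"
    using degree_prod_linear_le[of "\<lambda>k. (r k)\<^sup>2" n] by (intro coeff_eq_0) simp
  have "integral {a..b} (\<lambda>t. (norm (V (Suc n) q t))\<^sup>2) =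
        (\<Sum>i\<le>n. coeff ?Q i * ?I (i + Suc q)) + (r n)\<^sup>2 * (\<Sum>i\<le>n. coeff ?Q i * ?I (i + q))"
    unfolding rec energy_step[OF V s] Suc.IH ..
  also have "(\<Sum>i\<le>n. coeff ?Q i * ?I (i + q)) = (\<Sum>i\<le>Suc n. coeff ?Q i * ?I (i + q))"
    by (simp add: top)
  also have "\<dots> = coeff ?Q 0 * ?I q + (\<Sum>i\<le>n. coeff ?Q (Suc i) * ?I (Suc i + q))"
    by (subst sum.atMost_Suc_shift) simp
  also have "(\<Sum>i\<le>n. coeff ?Q i * ?I (i + Suc q)) + (r n)\<^sup>2 * \<dots> =
    coeff (?Q * [:(r n)\<^sup>2, 1:]) 0 * ?I (0 + q)
     + (\<Sum>i\<le>n. coeff (?Q * [:(r n)\<^sup>2, 1:]) (Suc i) * ?I (Suc i + q))"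
    unfolding coeff_linear_mult_0 coeff_linear_mult_Suc
    by (simp add: algebra_simps sum.distrib sum_distrib_left)
  also have "\<dots> = (\<Sum>i\<le>Suc n. coeff (\<Prod>k<Suc n. [:(r k)\<^sup>2, 1:]) i * ?I (i + q))"
    by (subst sum.atMost_Suc_shift) (simp only: prod.lessThan_Suc)
  finally show ?case .
qed simp

lemma coeff_prod_linear_nonneg:
  fixes a :: "'i \<Rightarrow> real"
  assumes "\<And>k. k \<in> A \<Longrightarrow> a k \<ge> 0"
  shows "coeff (\<Prod>k\<in>A. [:a k, 1:]) i \<ge> 0"
  using assms
proof (induction A arbitrary: i rule: infinite_finite_induct)
  case (insert x F)
  then show ?case
    by (cases i) (auto simp: mult.commute[of "[:a x, 1:]"] simp del: mult_pCons_left mult_pCons_right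
        simp: coeff_linear_mult_0 coeff_linear_mult_Suc)
qed (auto simp: coeff_1)

lemma coeff_prod_linear_0: "coeff (\<Prod>k\<in>A. [:a k, 1:]) 0 = (\<Prod>k\<in>A. a k)"
  for a :: "'i \<Rightarrow> real"
  by (induction A rule: infinite_finite_induct) auto

lemma coeff_prod_linear_1:
  fixes a :: "'i \<Rightarrow> real"
  assumes "finite A"
  shows "coeff (\<Prod>k\<in>A. [:a k, 1:]) 1 = (\<Sum>k\<in>A. \<Prod>j\<in>A - {k}. a j)"
  using assms
proof (induction A)
  case (insert x F)
  have "(\<Prod>j\<in>insert x F - {k}. a j) = a x * (\<Prod>j\<in>F - {k}. a j)" if "k \<in> F" for k
    using insert that by (subst insert_Diff_if) auto
  then have "(\<Sum>k\<in>F. \<Prod>j\<in>insert x F - {k}. a j) = a x * (\<Sum>k\<in>F. \<Prod>j\<in>F - {k}. a j)"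
    by (simp add: sum_distrib_left)
  then show ?case
    using insert by (simp add: coeff_prod_linear_0)
qed simp

lemma coeff_prod_linear_top:
  fixes a :: "'i \<Rightarrow> real"
  shows "coeff (\<Prod>k\<in>A. [:a k, 1:]) (card A) = 1"
proof -
  have "lead_coeff (\<Prod>k\<in>A. [:a k, 1:]) = 1"
    by (simp add: lead_coeff_prod)
  moreover have "degree (\<Prod>k\<in>A. [:a k, 1:]) = card A"
    by (subst degree_prod_eq_sum_degree) auto
  ultimately show ?thesis by simp
qed

text \<open>In effect minus the variable is put for the squared one: each of the \<open>m\<close>
  factors contributes a sign, and so does each of the \<open>i\<close> powers.\<close>

lemma coeff_prod_quadratic:
  fixes a :: "nat \<Rightarrow> real"
  shows "coeff (\<Prod>j=1..m. monom 1 2 - [:a j:]) (2 * i) = (-1) ^ (m + i) * coeff (\<Prod>j=1..m. [:a j, 1:]) i"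
proof (induction m arbitrary: i)
  case 0
  then show ?case by (cases i) auto
next
  case (Suc m)
  let ?P = "\<Prod>j=1..m. monom 1 2 - [:a j:]"
  have *: "(\<Prod>j=1..Suc m. monom 1 2 - [:a j:]) = monom 1 2 * ?P - smult (a (Suc m)) ?P"
    by (simp add: algebra_simps)
  have **: "(\<Prod>j=1..Suc m. [:a j, 1:]) = (\<Prod>j=1..m. [:a j, 1:]) * [:a (Suc m), 1:]"
    by simp
  show ?case
  proof (cases i)
    case 0
    then show ?thesis
      unfolding * ** coeff_linear_mult_0 coeff_diff coeff_smult coeff_monom_mult Suc.IH by simp
  next
    case (Suc i')
    have e: "2 * Suc i' - 2 = 2 * i'" by simp
    show ?thesis
      unfolding * ** Suc coeff_linear_mult_Suc coeff_diff coeff_smult coeff_monom_mult Suc.IH e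
      by (simp add: algebra_simps)
  qed
qed

text \<open>The polynomial behind \<open>c_const\<close>, with minus the variable in place of the
  squared one and the overall sign removed. Its coefficients are nonnegative, hence the absolute
  values of the even coefficients.\<close>

definition hardy_poly :: "nat \<Rightarrow> real \<Rightarrow> real poly" where
  "hardy_poly l \<alpha> = (\<Prod>j=1..l. [:((2 * real j - 1 - \<alpha>) / 2)\<^sup>2, 1:])"

lemma coeff_hardy_poly_nonneg: "coeff (hardy_poly l \<alpha>) i \<ge> 0"
  by (simp add: hardy_poly_def coeff_prod_linear_nonneg)

lemma coeff_hardy_poly_0: "coeff (hardy_poly l \<alpha>) 0 = A_const l \<alpha>"
  by (simp add: hardy_poly_def coeff_prod_linear_0 A_const_def)

text \<open>Each summand of the linear coefficient has only \<open>l - 1\<close> factors, so it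
  carries one factor 1/4 fewer than the normalisation of \<open>B_const\<close>.\<close>

lemma coeff_hardy_poly_1:
  assumes "l \<ge> 1"
  shows "coeff (hardy_poly l \<alpha>) 1 = 4 * B_const l \<alpha>"
proof -
  have "(\<Prod>j\<in>{1..l} - {k}. ((2 * real j - 1 - \<alpha>) / 2)\<^sup>2) =
        4 / 4 ^ l * (\<Prod>j\<in>{1..l} - {k}. (2 * real j - 1 - \<alpha>)\<^sup>2)" if "k \<in> {1..l}" for k
  proof -
    have "card ({1..l} - {k}) = l - 1"
      using that by simp
    then have "(\<Prod>j\<in>{1..l} - {k}. (4::real)) = 4 ^ l / 4"
      using assms by (simp add: power_diff)
    then have "(\<Prod>j\<in>{1..l} - {k}. (2 * real j - 1 - \<alpha>)\<^sup>2 / 4) =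
        (\<Prod>j\<in>{1..l} - {k}. (2 * real j - 1 - \<alpha>)\<^sup>2) / (4 ^ l / 4)"
      by (simp only: prod_dividef)
    then show ?thesis
      by (simp add: power_divide)
  qed
  then show ?thesis
    by (simp add: hardy_poly_def coeff_prod_linear_1[unfolded One_nat_def] B_const_def sum_distrib_left)
qed

lemma coeff_hardy_poly_top: "coeff (hardy_poly l \<alpha>) l = 1"
  using coeff_prod_linear_top[of _ "{1..l}"] by (simp add: hardy_poly_def)

lemma abs_c_const: "\<bar>c_const (2 * i) l \<alpha>\<bar> = coeff (hardy_poly l \<alpha>) i"
proof -
  have "c_const (2 * i) l \<alpha> = (-1) ^ (l + i) * coeff (hardy_poly l \<alpha>) i"
    unfolding c_const_def hardy_poly_def coeff_prod_quadratic by (simp add: power_divide)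
  then show ?thesis
    using coeff_hardy_poly_nonneg[of l \<alpha> i] by (simp add: abs_mult)
qed

text \<open>Each differentiation lowers the shift by one, so the roots arise in descending order;
  \<open>j = l - k\<close> restores the indexing of \<open>hardy_poly\<close>.\<close>

lemma hardy_poly_descending:
  "(\<Prod>k<l. [:((2 * real l - 1 - \<alpha>) / 2 - real k)\<^sup>2, 1:]) = hardy_poly l \<alpha>"
  unfolding hardy_poly_def
  by (rule prod.reindex_bij_witness[of _ "\<lambda>j. l - j" "\<lambda>k. l - k"])
     (auto simp: of_nat_diff field_simps)

subsection \<open>Logarithmic change of variables\<close>

text \<open>In the variable \<open>t = s ln x + d\<close> with \<open>s = \<plusminus>1\<close>, the functions \<open>x powr (n - \<beta>) * F n x\<close>
  satisfy \<open>v (n+1) = s * v n' + (\<beta> - n) * v n\<close>. Solving for \<open>v n'\<close> expresses all higher derivatives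
  (indexed by the recursion variable) in terms of the family itself.\<close>

primrec log_chain ::
  "real \<Rightarrow> real \<Rightarrow> real \<Rightarrow> (nat \<Rightarrow> real \<Rightarrow> 'a::real_normed_vector) \<Rightarrow> nat \<Rightarrow> nat \<Rightarrow> real \<Rightarrow> 'a" where
  "log_chain s d \<beta> F 0 = (\<lambda>n t. exp ((real n - \<beta>) * (s * (t - d))) *\<^sub>R F n (exp (s * (t - d))))"
| "log_chain s d \<beta> F (Suc q) =
     (\<lambda>n t. s *\<^sub>R (log_chain s d \<beta> F q (Suc n) t - (\<beta> - real n) *\<^sub>R log_chain s d \<beta> F q n t))"

lemma log_chain_deriv:
  assumes F: "smooth_chain a b F" and s: "s = 1 \<or> s = -1"
  shows "(log_chain s d \<beta> F q n has_vector_derivative log_chain s d \<beta> F (Suc q) n t) (at t)"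
proof (induction q arbitrary: n)
  case 0
  let ?x = "\<lambda>t. exp (s * (t - d))"
  have x: "(?x has_vector_derivative s * ?x t) (at t)"
    unfolding has_real_derivative_iff_has_vector_derivative[symmetric]
    by (auto intro!: derivative_eq_intros)
  have "((\<lambda>t. F n (?x t)) has_vector_derivative (s * ?x t) *\<^sub>R F (Suc n) (?x t)) (at t)"
    using vector_diff_chain_at[OF x smooth_chain_deriv[OF F]] by (simp add: o_def)
  moreover have "((\<lambda>t. exp ((real n - \<beta>) * (s * (t - d)))) has_field_derivative
       (real n - \<beta>) * s * exp ((real n - \<beta>) * (s * (t - d)))) (at t)"
    by (auto intro!: derivative_eq_intros)
  ultimately have "(log_chain s d \<beta> F 0 n has_vector_derivative
      exp ((real n - \<beta>) * (s * (t - d))) *\<^sub>R (s * ?x t) *\<^sub>R F (Suc n) (?x t)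
      + ((real n - \<beta>) * s * exp ((real n - \<beta>) * (s * (t - d)))) *\<^sub>R F n (?x t)) (at t)"
    unfolding log_chain.simps by (rule has_vector_derivative_scaleR[rotated])
  \<comment> \<open>The factor \<open>?x t\<close> from the chain rule raises the weight exponent to
    the one belonging to \<open>Suc n\<close>.\<close>
  moreover have "exp ((real (Suc n) - \<beta>) * (s * (t - d))) = exp ((real n - \<beta>) * (s * (t - d))) * ?x t"
    by (simp add: exp_add[symmetric] algebra_simps)
  ultimately show ?case
    by (simp add: algebra_simps)
next
  case (Suc q)
  show ?case
    unfolding log_chain.simps(2)[of s d \<beta> F "Suc q"] log_chain.simps(2)[of s d \<beta> F q]
    by (rule bounded_linear.has_vector_derivative[OF bounded_linear_scaleR_right]
          has_vector_derivative_diff Suc.IH[unfolded log_chain.simps(2)])+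
qed

text \<open>Since dt = s dx / x, squaring \<open>x powr (n - \<beta>)\<close> and dividing by
  \<open>x\<close> yields the exponent in the last clause. The clause on \<open>a'\<close> serves to
  locate the support of \<open>V\<close> in the half-line of the induction hypothesis.\<close>

lemma log_change_of_variables:
  fixes F :: "nat \<Rightarrow> real \<Rightarrow> 'a::real_normed_vector"
  assumes F: "smooth_chain a b F" and nz: "F 0 x0 \<noteq> 0" and a: "0 < a" and s: "s = 1 \<or> s = -1"
  obtains a' b' and V :: "nat \<Rightarrow> nat \<Rightarrow> real \<Rightarrow> 'a" where
    "\<And>n. smooth_chain a' b' (V n)"
    "\<And>n q t. V (Suc n) q t = s *\<^sub>R V n (Suc q) t + (\<beta> - real n) *\<^sub>R V n q t"
    "\<exists>t. V 0 0 t \<noteq> 0"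
    "a' \<in> (\<lambda>x. s * ln x + d) ` {a..b}"
    "\<And>n w. continuous_on {a'..b'} w \<Longrightarrow>
       integral {a..b} (\<lambda>x. x powr (2 * real n - 2 * \<beta> - 1) * w (s * ln x + d) * (norm (F n x))\<^sup>2) =
       integral {a'..b'} (\<lambda>t. w t * (norm (V n 0 t))\<^sup>2)"
proof -
  define V where "V n q = log_chain s d \<beta> F q n" for n q
  define g where "g x = s * ln x + d" for x
  \<comment> \<open>For \<open>s = -1\<close> the map \<open>g\<close> reverses the order of the
    endpoints.\<close>
  define a' where "a' = min (g a) (g b)"
  define b' where "b' = max (g a) (g b)"
  have x0: "a \<le> x0" "x0 \<le> b"
    using nz smooth_chain_outside[OF F] by force+
  then have ab: "a \<le> b" by simp
  have rec: "V (Suc n) q t = s *\<^sub>R V n (Suc q) t + (\<beta> - real n) *\<^sub>R V n q t" for n q t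
    using s by (auto simp: V_def)
  have V0g: "V n 0 (g x) = x powr (real n - \<beta>) *\<^sub>R F n x" if "x > 0" for n x
    using s that by (auto simp: V_def g_def powr_def)
  have out0: "V n 0 t = 0" if "t \<notin> {a'..b'}" for n t
  proof -
    have "exp (s * (t - d)) \<notin> {a..b}"
    proof
      assume "exp (s * (t - d)) \<in> {a..b}"
      then have "ln a \<le> s * (t - d)" "s * (t - d) \<le> ln b"
        using a ab by (auto simp: ln_ge_iff[symmetric] ln_le_cancel_iff[symmetric] simp del: ln_le_cancel_iff)
      then show False
        using that s by (auto simp: a'_def b'_def g_def)
    qed
    then show ?thesis
      using smooth_chain_outside[OF F] by (simp add: V_def)
  qed
  \<comment> \<open>Raising \<open>q\<close> takes pointwise linear combinations, so vanishing at
    \<open>t\<close> for \<open>q = 0\<close> and all \<open>n\<close> passes to every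
    \<open>q\<close>.\<close>
  have out: "V n q t = 0" if "t \<notin> {a'..b'}" for n q t
  proof (induction q arbitrary: n)
    case (Suc q)
    then show ?case by (simp add: V_def)
  qed (rule out0[OF that])
  have chain: "smooth_chain a' b' (V n)" for n
    unfolding smooth_chain_def using out log_chain_deriv[OF F s] by (auto simp: V_def)
  have range: "g ` {a..b} \<subseteq> {a'..b'}"
    using s a by (auto simp: a'_def b'_def g_def)
  have subst: "integral {a..b} (\<lambda>x. x powr (2 * real n - 2 * \<beta> - 1) * w (g x) * (norm (F n x))\<^sup>2) =
       integral {a'..b'} (\<lambda>t. w t * (norm (V n 0 t))\<^sup>2)"
    if w: "continuous_on {a'..b'} w" for n w
  proof -
    let ?f = "\<lambda>t. w t * (norm (V n 0 t))\<^sup>2"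
    \<comment> \<open>At least one of the two integrals on the right is over an empty or degenerate
      interval; the factor \<open>s\<close> afterwards corrects the orientation.\<close>
    have "((\<lambda>x. (s / x) *\<^sub>R ?f (g x)) has_integral (integral {g a..g b} ?f - integral {g b..g a} ?f)) {a..b}"
    proof (rule has_integral_substitution_general[OF _ ab range])
      show "continuous_on {a'..b'} ?f"
        by (intro continuous_intros w smooth_chain_continuous[OF chain])
      show "continuous_on {a..b} g"
        unfolding g_def using a by (auto intro!: continuous_intros)
      show "(g has_field_derivative s / x) (at x within {a..b})" if "x \<in> {a..b} - {}" for x
        unfolding g_def using a that by (auto intro!: derivative_eq_intros)
    qed simp
    then have "((\<lambda>x. s * ((s / x) *\<^sub>R ?f (g x))) has_integral
        s * (integral {g a..g b} ?f - integral {g b..g a} ?f)) {a..b}"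
      by (rule has_integral_mult_right)
    moreover have "s * (integral {g a..g b} ?f - integral {g b..g a} ?f) = integral {a'..b'} ?f"
    proof (cases "a = b")
      case True
      then show ?thesis by (simp add: a'_def b'_def)
    next
      case False
      then have "ln a < ln b" using ab a by simp
      then show ?thesis
        using s by (auto simp: a'_def b'_def g_def)
    qed
    moreover have "s * ((s / x) *\<^sub>R ?f (g x)) =
        x powr (2 * real n - 2 * \<beta> - 1) * w (g x) * (norm (F n x))\<^sup>2" if "x \<in> {a..b}" for x
    proof -
      have x: "x > 0" using that a by simp
      have "(x powr (real n - \<beta>))\<^sup>2 / x = x powr ((real n - \<beta>) + (real n - \<beta>) - 1)"
        unfolding powr_diff[of x _ 1] powr_add using x by (simp add: power2_eq_square)
      then have "(x powr (real n - \<beta>))\<^sup>2 / x = x powr (2 * real n - 2 * \<beta> - 1)"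
        by (simp add: algebra_simps)
      moreover have "s * ((s / x) *\<^sub>R ?f (g x)) =
          (s * s) * ((x powr (real n - \<beta>))\<^sup>2 / x) * w (g x) * (norm (F n x))\<^sup>2"
        using x by (simp add: V0g power_mult_distrib)
      ultimately show ?thesis
        using s by auto
    qed
    ultimately have "((\<lambda>x. x powr (2 * real n - 2 * \<beta> - 1) * w (g x) * (norm (F n x))\<^sup>2) has_integral
        integral {a'..b'} ?f) {a..b}"
      by (metis (no_types, lifting) has_integral_eq)
    then show ?thesis
      by (rule integral_unique)
  qed
  show thesis
  proof (rule that[of a' b' V])
    show "\<exists>t. V 0 0 t \<noteq> 0"
      using nz V0g[of x0 0] x0 a by (intro exI[of _ "g x0"]) simp
    show "a' \<in> (\<lambda>x. s * ln x + d) ` {a..b}"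
      using ab by (auto simp: a'_def g_def min_def)
  qed (use chain rec subst in \<open>simp_all add: g_def\<close>)
qed

subsection \<open>The induction on the number of logarithms\<close>

text \<open>The induction hypothesis: the case \<alpha> = 0 on the half-line beyond
  \<open>c\<close>, for all orders at once because the energy expansion calls for every order from 1
  to \<open>l\<close>. Continuity of the weights is carried along for the next change of
  variables.\<close>

definition halfline_hardy ::
  "'a::complex_inner_space itself \<Rightarrow> nat \<Rightarrow> real \<Rightarrow> (nat \<Rightarrow> real \<Rightarrow> real) \<Rightarrow> bool" where
  "halfline_hardy TYPE('a) N c W \<longleftrightarrow> 0 \<le> c \<and> (\<forall>p\<in>{1..N}. continuous_on {c<..} (W p)) \<and>
     (\<forall>l a b (F :: nat \<Rightarrow> real \<Rightarrow> 'a). 1 \<le> l \<longrightarrow> smooth_chain a b F \<longrightarrow> c < a \<longrightarrow> (\<exists>x. F 0 x \<noteq> 0) \<longrightarrow>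
        A_const l 0 * integral {a..b} (\<lambda>t. inverse t ^ (2 * l) * (norm (F 0 t))\<^sup>2)
        + B_const l 0 * (\<Sum>k=1..N. integral {a..b}
            (\<lambda>t. inverse t ^ (2 * l) * (\<Prod>p=1..k. (W p t)\<^sup>2) * (norm (F 0 t))\<^sup>2))
        < integral {a..b} (\<lambda>t. (norm (F l t))\<^sup>2))"

lemma A_const_nonneg: "A_const l \<alpha> \<ge> 0"
  by (simp add: A_const_def prod_nonneg)

lemma B_const_nonneg: "B_const l \<alpha> \<ge> 0"
  by (simp add: B_const_def prod_nonneg sum_nonneg)

lemma A_const_1_0: "A_const 1 0 = 1 / 4" and B_const_1_0: "B_const 1 0 = 1 / 4"
  by (simp_all add: A_const_def B_const_def power_divide)

lemma powr_neg_even: "x > 0 \<Longrightarrow> x powr (- (2 * real l)) = inverse x ^ (2 * l)"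
  by (simp add: powr_minus powr_realpow[symmetric] power_inverse)

text \<open>Without logarithms this is the power-weight Hardy inequality of order \<open>l\<close>.
  Of the energy expansion only the indices 0 and \<open>l\<close> are kept: the first is the term to
  be bounded, the second is positive.\<close>

lemma halfline_hardy_base:
  assumes "0 \<le> c"
  shows "halfline_hardy TYPE('a::complex_inner_space) 0 c W"
proof -
  have "A_const l 0 * integral {a..b} (\<lambda>t. inverse t ^ (2 * l) * (norm (F 0 t))\<^sup>2)
      < integral {a..b} (\<lambda>t. (norm (F l t))\<^sup>2)"
    if l: "1 \<le> l" and F: "smooth_chain a b F" and a: "c < a" and nz: "F 0 x0 \<noteq> 0"
    for l a b and F :: "nat \<Rightarrow> real \<Rightarrow> 'a" and x0
  proof -
    have a0: "0 < a" using a assms by simp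
    \<comment> \<open>Chosen so that the weight exponent is \<open>- (2 * l)\<close> for
      \<open>n = 0\<close> and 0 for \<open>n = l\<close>.\<close>
    define \<beta> where "\<beta> = (2 * real l - 1) / 2"
    obtain a' b' and V :: "nat \<Rightarrow> nat \<Rightarrow> real \<Rightarrow> 'a" where V: "\<And>n. smooth_chain a' b' (V n)"
      and rec: "\<And>n q t. V (Suc n) q t = 1 *\<^sub>R V n (Suc q) t + (\<beta> - real n) *\<^sub>R V n q t"
      and Vnz: "\<exists>t. V 0 0 t \<noteq> 0"
      and sub: "\<And>n w. continuous_on {a'..b'} w \<Longrightarrow>
       integral {a..b} (\<lambda>x. x powr (2 * real n - 2 * \<beta> - 1) * w (1 * ln x + 0) * (norm (F n x))\<^sup>2) =
       integral {a'..b'} (\<lambda>t. w t * (norm (V n 0 t))\<^sup>2)"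
      by (rule log_change_of_variables[OF F nz a0, of 1 \<beta> 0]) auto
    have \<beta>: "2 * real 0 - 2 * \<beta> - 1 = - (2 * real l)" "2 * real l - 2 * \<beta> - 1 = 0"
      by (simp_all add: \<beta>_def field_simps)
    have "integral {a..b} (\<lambda>t. inverse t ^ (2 * l) * (norm (F 0 t))\<^sup>2) =
        integral {a'..b'} (\<lambda>t. (norm (V 0 0 t))\<^sup>2)"
    proof -
      have "integral {a..b} (\<lambda>t. inverse t ^ (2 * l) * (norm (F 0 t))\<^sup>2) =
          integral {a..b} (\<lambda>x. x powr (2 * real 0 - 2 * \<beta> - 1) * 1 * (norm (F 0 x))\<^sup>2)"
        unfolding \<beta> by (rule integral_cong) (use a0 in \<open>auto simp: powr_neg_even[symmetric]\<close>)
      then show ?thesis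
        using sub[of "\<lambda>_. 1" 0] by simp
    qed
    moreover have "integral {a..b} (\<lambda>t. (norm (F l t))\<^sup>2) = integral {a'..b'} (\<lambda>t. (norm (V l 0 t))\<^sup>2)"
    proof -
      have "integral {a..b} (\<lambda>t. (norm (F l t))\<^sup>2) =
          integral {a..b} (\<lambda>x. x powr (2 * real l - 2 * \<beta> - 1) * 1 * (norm (F l x))\<^sup>2)"
        unfolding \<beta> by (rule integral_cong) (use a0 in auto)
      then show ?thesis
        using sub[of "\<lambda>_. 1" l] by simp
    qed
    moreover have "integral {a'..b'} (\<lambda>t. (norm (V l 0 t))\<^sup>2) =
        (\<Sum>i\<le>l. coeff (hardy_poly l 0) i * integral {a'..b'} (\<lambda>t. (norm (V 0 i t))\<^sup>2))"
      using energy_expansion[where V = V and r = "\<lambda>n. \<beta> - real n", OF V _ rec, of l 0] hardy_poly_descending[of l 0]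
      by (simp add: \<beta>_def)
    moreover have "A_const l 0 * integral {a'..b'} (\<lambda>t. (norm (V 0 0 t))\<^sup>2) < \<dots>"
    proof -
      have pos: "integral {a'..b'} (\<lambda>t. (norm (V 0 i t))\<^sup>2) > 0" for i
        using energy_pos[OF V] Vnz by blast
      have "(\<Sum>i\<in>{0,l}. coeff (hardy_poly l 0) i * integral {a'..b'} (\<lambda>t. (norm (V 0 i t))\<^sup>2))
        \<le> (\<Sum>i\<le>l. coeff (hardy_poly l 0) i * integral {a'..b'} (\<lambda>t. (norm (V 0 i t))\<^sup>2))"
        by (rule sum_mono2) (auto intro!: mult_nonneg_nonneg coeff_hardy_poly_nonneg less_imp_le[OF pos])
      then show ?thesis
        using l pos[of l] by (simp add: coeff_hardy_poly_0 coeff_hardy_poly_top)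
    qed
    ultimately show ?thesis by simp
  qed
  then show ?thesis
    using assms unfolding halfline_hardy_def by auto
qed

text \<open>The energy of index 0 is exactly the \<open>A_const\<close> integral. Each energy of
  index \<open>i \<ge> 1\<close> is bounded below by the half-line inequality of order
  \<open>i\<close>: index 1 yields the \<open>B_const\<close> terms, the others yield the two
  remaining sums. One logarithm is gained because \<open>W 1\<close> is the reciprocal of the new
  variable.\<close>

lemma log_hardy_ineq:
  fixes \<alpha> :: real and F :: "nat \<Rightarrow> real \<Rightarrow> 'a::complex_inner_space"
  assumes hh: "halfline_hardy TYPE('a) N c W'"
    and F: "smooth_chain a b F" and nz: "F 0 x0 \<noteq> 0" and a: "0 < a" and s: "s = 1 \<or> s = -1"
    and l: "1 \<le> l"
    and \<tau>: "\<And>x. x \<in> {a..b} \<Longrightarrow> c < s * ln x + d"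
    and W1: "\<And>x. x \<in> {a..b} \<Longrightarrow> W 1 x = inverse (s * ln x + d)"
    and WS: "\<And>p x. 1 \<le> p \<Longrightarrow> p \<le> N \<Longrightarrow> x \<in> {a..b} \<Longrightarrow> W (Suc p) x = W' p (s * ln x + d)"
  defines "K \<equiv> \<lambda>w. integral {a..b} (\<lambda>x. x powr (\<alpha> - 2 * real l) * w x * (norm (F 0 x))\<^sup>2)"
  shows "A_const l \<alpha> * K (\<lambda>x. 1)
     + (B_const l \<alpha> * (\<Sum>k=1..Suc N. K (\<lambda>x. \<Prod>p=1..k. (W p x)\<^sup>2))
       + (\<Sum>j=2..l. \<bar>c_const (2 * j) l \<alpha>\<bar> * A_const j 0 * K (\<lambda>x. W 1 x ^ (2 * j)))
       + (\<Sum>j=2..l. \<bar>c_const (2 * j) l \<alpha>\<bar> * B_const j 0 *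
            (\<Sum>k=1..N. K (\<lambda>x. W 1 x ^ (2 * j) * (\<Prod>p=1..k. (W (p + 1) x)\<^sup>2)))))
     < integral {a..b} (\<lambda>x. x powr \<alpha> * 1 * (norm (F l x))\<^sup>2)"
proof -
  define \<beta> where "\<beta> = (2 * real l - 1 - \<alpha>) / 2"
  obtain a' b' and V :: "nat \<Rightarrow> nat \<Rightarrow> real \<Rightarrow> 'a" where V: "\<And>n. smooth_chain a' b' (V n)"
    and rec: "\<And>n q t. V (Suc n) q t = s *\<^sub>R V n (Suc q) t + (\<beta> - real n) *\<^sub>R V n q t"
    and Vnz: "\<exists>t. V 0 0 t \<noteq> 0"
    and a': "a' \<in> (\<lambda>x. s * ln x + d) ` {a..b}"
    and sub: "\<And>n w. continuous_on {a'..b'} w \<Longrightarrow>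
     integral {a..b} (\<lambda>x. x powr (2 * real n - 2 * \<beta> - 1) * w (s * ln x + d) * (norm (F n x))\<^sup>2) =
     integral {a'..b'} (\<lambda>t. w t * (norm (V n 0 t))\<^sup>2)"
    by (rule log_change_of_variables[OF F nz a s, of \<beta> d]) blast
  have c: "0 \<le> c" and cW': "\<And>p. p \<in> {1..N} \<Longrightarrow> continuous_on {c<..} (W' p)"
    using hh by (auto simp: halfline_hardy_def)
  have ca': "c < a'" using a' \<tau> by auto
  note [continuous_intros] = continuous_on_subset[OF cW', of _ "{a'..b'}"]
  define J where "J w = integral {a'..b'} (\<lambda>t. w t * (norm (V 0 0 t))\<^sup>2)" for w
  define E where "E i = integral {a'..b'} (\<lambda>t. (norm (V 0 i t))\<^sup>2)" for i
  define C where "C i = coeff (hardy_poly l \<alpha>) i" for i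
  define D where "D i = A_const i 0 * J (\<lambda>t. inverse t ^ (2 * i))
      + B_const i 0 * (\<Sum>k=1..N. J (\<lambda>t. inverse t ^ (2 * i) * (\<Prod>p=1..k. (W' p t)\<^sup>2)))" for i
  have C_nonneg: "C i \<ge> 0" for i
    by (simp add: C_def coeff_hardy_poly_nonneg)
  have \<beta>0: "2 * real 0 - 2 * \<beta> - 1 = \<alpha> - 2 * real l"
    by (simp add: \<beta>_def field_simps)
  have K_eq: "K w' = J w"
    if "continuous_on {a'..b'} w" "\<And>x. x \<in> {a..b} \<Longrightarrow> w' x = w (s * ln x + d)" for w w'
  proof -
    have "K w' = integral {a..b} (\<lambda>x. x powr (2 * real 0 - 2 * \<beta> - 1) * w (s * ln x + d) * (norm (F 0 x))\<^sup>2)"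
      unfolding K_def by (rule integral_cong) (simp only: that(2) \<beta>0)
    then show ?thesis
      using sub[OF that(1), of 0] by (simp add: J_def)
  qed
  have c1: "continuous_on {a'..b'} (\<lambda>t. inverse t ^ i)" for i
    using ca' c by (intro continuous_intros) auto
  have c2: "continuous_on {a'..b'} (\<lambda>t. inverse t ^ i * (\<Prod>p=1..k. (W' p t)\<^sup>2))" if "k \<le> N" for i k
    using ca' that by (intro continuous_intros c1) auto
  have K0: "K (\<lambda>x. 1) = E 0"
    using K_eq[of "\<lambda>_. 1" "\<lambda>_. 1"] by (simp add: J_def E_def)
  have K1: "K (\<lambda>x. W 1 x ^ (2 * j)) = J (\<lambda>t. inverse t ^ (2 * j))" for j
    by (rule K_eq[OF c1]) (simp only: W1)
  have K2: "K (\<lambda>x. W 1 x ^ (2 * j) * (\<Prod>p=1..k. (W (p + 1) x)\<^sup>2)) =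
      J (\<lambda>t. inverse t ^ (2 * j) * (\<Prod>p=1..k. (W' p t)\<^sup>2))" if "k \<le> N" for j k
    using that by (intro K_eq[OF c2]) (auto simp: W1[simplified] WS)
  have K2_sum: "(\<Sum>k=1..N. K (\<lambda>x. W 1 x ^ (2 * j) * (\<Prod>p=1..k. (W (p + 1) x)\<^sup>2))) =
      (\<Sum>k=1..N. J (\<lambda>t. inverse t ^ (2 * j) * (\<Prod>p=1..k. (W' p t)\<^sup>2)))" for j
    by (intro sum.cong refl K2) simp
  have prod_split: "(\<Prod>p=1..Suc k. (W p x)\<^sup>2) = W 1 x ^ (2 * 1) * (\<Prod>p=1..k. (W (p + 1) x)\<^sup>2)" for k x
  proof -
    have "(\<Prod>p=1..Suc k. (W p x)\<^sup>2) = (W 1 x)\<^sup>2 * (\<Prod>p=Suc 1..Suc k. (W p x)\<^sup>2)"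
      by (rule prod.atLeast_Suc_atMost) simp
    then show ?thesis
      unfolding prod.shift_bounds_cl_Suc_ivl by simp
  qed
  \<comment> \<open>The term \<open>k = 1\<close> has no factor \<open>W'\<close> and is the
    \<open>A_const\<close> part of \<open>D 1\<close>; the others form its \<open>B_const\<close>
    part. Both constants are 1/4 at order 1, which produces the 4 needed to match
    \<open>coeff_hardy_poly_1\<close>.\<close>
  have KB: "(\<Sum>k=1..Suc N. K (\<lambda>x. \<Prod>p=1..k. (W p x)\<^sup>2)) = 4 * D 1"
  proof -
    have "(\<Sum>k=1..Suc N. K (\<lambda>x. \<Prod>p=1..k. (W p x)\<^sup>2)) = (\<Sum>k=0..N. K (\<lambda>x. \<Prod>p=1..Suc k. (W p x)\<^sup>2))"
      by (simp only: One_nat_def sum.shift_bounds_cl_Suc_ivl)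
    also have "\<dots> = (\<Sum>k=0..N. J (\<lambda>t. inverse t ^ (2 * 1) * (\<Prod>p=1..k. (W' p t)\<^sup>2)))"
      unfolding prod_split by (intro sum.cong refl K2) simp
    also have "\<dots> = 4 * D 1"
      unfolding D_def A_const_1_0 B_const_1_0
      by (subst sum.atLeast_Suc_atMost) auto
    finally show ?thesis .
  qed
  \<comment> \<open>By \<open>ca'\<close> the support of \<open>V 0\<close> lies in the half-line,
    so the hypothesis applies to the chain \<open>V 0\<close> with order \<open>i\<close>.\<close>
  have DE: "D i < E i" if "1 \<le> i" for i
    using hh that V[of 0] ca' Vnz unfolding halfline_hardy_def D_def E_def J_def by blast
  have "integral {a..b} (\<lambda>x. x powr \<alpha> * 1 * (norm (F l x))\<^sup>2) = integral {a'..b'} (\<lambda>t. (norm (V l 0 t))\<^sup>2)"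
  proof -
    have "2 * real l - 2 * \<beta> - 1 = \<alpha>" by (simp add: \<beta>_def field_simps)
    then show ?thesis
      using sub[of "\<lambda>_. 1" l] by simp
  qed
  also have "\<dots> = (\<Sum>i\<le>l. C i * E i)"
    using energy_expansion[where V = V and r = "\<lambda>n. \<beta> - real n", OF V _ rec, of l 0] hardy_poly_descending[of l \<alpha>] s
    by (auto simp: \<beta>_def C_def E_def)
  also have "\<dots> = C 0 * E 0 + (\<Sum>i=1..l. C i * E i)"
    by (simp add: atMost_atLeast0 sum.atLeast_Suc_atMost)
  also have "\<dots> > C 0 * E 0 + (\<Sum>i=1..l. C i * D i)"
  proof -
    have "(\<Sum>i=1..l. C i * D i) < (\<Sum>i=1..l. C i * E i)"
    proof (rule sum_strict_mono_ex1)
      show "\<exists>i\<in>{1..l}. C i * D i < C i * E i"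
        using DE[OF l] l by (intro bexI[of _ l]) (auto simp: C_def coeff_hardy_poly_top)
    qed (use DE C_nonneg in \<open>auto simp: less_eq_real_def[of "D _"] intro!: mult_left_mono\<close>)
    then show ?thesis by simp
  qed
  also have "(\<Sum>i=1..l. C i * D i) = C 1 * D 1 + (\<Sum>i=2..l. C i * D i)"
    using l by (subst sum.atLeast_Suc_atMost) (auto simp: numeral_2_eq_2)
  also have "C 1 * D 1 = B_const l \<alpha> * (\<Sum>k=1..Suc N. K (\<lambda>x. \<Prod>p=1..k. (W p x)\<^sup>2))"
    unfolding KB C_def coeff_hardy_poly_1[OF l] by simp
  also have "(\<Sum>i=2..l. C i * D i) =
      (\<Sum>j=2..l. \<bar>c_const (2 * j) l \<alpha>\<bar> * A_const j 0 * K (\<lambda>x. W 1 x ^ (2 * j)))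
       + (\<Sum>j=2..l. \<bar>c_const (2 * j) l \<alpha>\<bar> * B_const j 0 *
            (\<Sum>k=1..N. K (\<lambda>x. W 1 x ^ (2 * j) * (\<Prod>p=1..k. (W (p + 1) x)\<^sup>2))))"
    unfolding abs_c_const C_def[symmetric] K1 K2_sum
    by (simp add: D_def distrib_left sum.distrib mult.assoc)
  finally show ?thesis
    by (simp add: C_def coeff_hardy_poly_0 K0 add_ac)
qed

text \<open>The set \<open>S\<close> is general: it is a half-line in the induction step and the
  support interval for test functions.\<close>

lemma continuous_on_log_weight:
  assumes hh: "halfline_hardy TYPE('a::complex_inner_space) N c W'" and S: "S \<subseteq> {0<..}"
    and \<tau>: "\<And>x. x \<in> S \<Longrightarrow> c < s * ln x + d"
    and W1: "\<And>x. x \<in> S \<Longrightarrow> W 1 x = inverse (s * ln x + d)"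
    and WS: "\<And>p x. 1 \<le> p \<Longrightarrow> p \<le> N \<Longrightarrow> x \<in> S \<Longrightarrow> W (Suc p) x = W' p (s * ln x + d)"
    and p: "p \<in> {1..Suc N}"
  shows "continuous_on S (W p)"
proof (cases "p = 1")
  have c: "0 \<le> c" using hh unfolding halfline_hardy_def by blast
  have ln: "continuous_on S (\<lambda>x. s * ln x + d)"
    using S by (intro continuous_intros) auto
  case True
  have "continuous_on S (\<lambda>x. inverse (s * ln x + d))"
    using \<tau> c by (intro continuous_intros ln) force
  then show ?thesis
    using True W1 by (simp cong: continuous_on_cong)
next
  have ln: "continuous_on S (\<lambda>x. s * ln x + d)"
    using S by (intro continuous_intros) auto
  case False
  then obtain q where q: "p = Suc q" "1 \<le> q" "q \<le> N"
    using p by (cases p) auto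
  have "continuous_on {c<..} (W' q)"
    using hh q unfolding halfline_hardy_def by auto
  then have "continuous_on S (\<lambda>x. W' q (s * ln x + d))"
    by (rule continuous_on_compose2[OF _ ln]) (use \<tau> in auto)
  then show ?thesis
    using q WS by (simp cong: continuous_on_cong)
qed

text \<open>This is \<open>log_hardy_ineq\<close> for \<alpha> = 0 and s = 1, after dropping the two
  sums over \<open>j \<ge> 2\<close>; they are nonnegative since the weights enter in even powers
  only.\<close>

lemma halfline_hardy_step:
  assumes hh: "halfline_hardy TYPE('a::complex_inner_space) N c W'" and c': "0 \<le> c'"
    and \<tau>: "\<And>x. c' < x \<Longrightarrow> c < ln x + d"
    and W1: "\<And>x. c' < x \<Longrightarrow> W 1 x = inverse (ln x + d)"
    and WS: "\<And>p x. 1 \<le> p \<Longrightarrow> p \<le> N \<Longrightarrow> c' < x \<Longrightarrow> W (Suc p) x = W' p (ln x + d)"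
  shows "halfline_hardy TYPE('a) (Suc N) c' W"
proof -
  have cont: "continuous_on {c'<..} (W p)" if "p \<in> {1..Suc N}" for p
    by (rule continuous_on_log_weight[OF hh _ _ _ _ that, where s = 1 and d = d]) (use assms in auto)
  have "A_const l 0 * integral {a..b} (\<lambda>t. inverse t ^ (2 * l) * (norm (F 0 t))\<^sup>2)
        + B_const l 0 * (\<Sum>k=1..Suc N. integral {a..b}
            (\<lambda>t. inverse t ^ (2 * l) * (\<Prod>p=1..k. (W p t)\<^sup>2) * (norm (F 0 t))\<^sup>2))
        < integral {a..b} (\<lambda>t. (norm (F l t))\<^sup>2)"
    if l: "1 \<le> l" and F: "smooth_chain a b F" and a: "c' < a" and nz: "F 0 x0 \<noteq> 0"
    for l a b and F :: "nat \<Rightarrow> real \<Rightarrow> 'a" and x0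
  proof -
    define K where "K w = integral {a..b} (\<lambda>x. x powr (0 - 2 * real l) * w x * (norm (F 0 x))\<^sup>2)" for w
    have K: "integral {a..b} (\<lambda>t. inverse t ^ (2 * l) * w t * (norm (F 0 t))\<^sup>2) = K w" for w
      unfolding K_def using a c' by (intro integral_cong) (simp add: powr_neg_even[symmetric])
    have R: "integral {a..b} (\<lambda>t. t powr 0 * 1 * (norm (F l t))\<^sup>2) = integral {a..b} (\<lambda>t. (norm (F l t))\<^sup>2)"
      using a c' by (intro integral_cong) simp
    have K_nonneg: "K w \<ge> 0" if "continuous_on {a..b} w" "\<And>x. w x \<ge> 0" for w
      unfolding K_def using a c' that
      by (intro integral_nonneg integrable_continuous_real continuous_intros smooth_chain_continuous[OF F]) auto
    have cW: "continuous_on {a..b} (W p)" if "p \<in> {1..Suc N}" for p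
      by (rule continuous_on_subset[OF cont[OF that]]) (use a in auto)
    have "A_const l 0 * K (\<lambda>x. 1)
     + (B_const l 0 * (\<Sum>k=1..Suc N. K (\<lambda>x. \<Prod>p=1..k. (W p x)\<^sup>2))
       + (\<Sum>j=2..l. \<bar>c_const (2 * j) l 0\<bar> * A_const j 0 * K (\<lambda>x. W 1 x ^ (2 * j)))
       + (\<Sum>j=2..l. \<bar>c_const (2 * j) l 0\<bar> * B_const j 0 *
            (\<Sum>k=1..N. K (\<lambda>x. W 1 x ^ (2 * j) * (\<Prod>p=1..k. (W (p + 1) x)\<^sup>2)))))
      < integral {a..b} (\<lambda>t. t powr 0 * 1 * (norm (F l t))\<^sup>2)"
      unfolding K_def
      by (rule log_hardy_ineq[OF hh F nz _ _ l, where s = 1 and d = d]) (use a assms in auto)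
    moreover have "0 \<le> (\<Sum>j=2..l. \<bar>c_const (2 * j) l 0\<bar> * A_const j 0 * K (\<lambda>x. W 1 x ^ (2 * j)))"
      by (intro sum_nonneg mult_nonneg_nonneg A_const_nonneg K_nonneg continuous_intros cW)
         (auto simp: power_mult)
    moreover have "0 \<le> (\<Sum>j=2..l. \<bar>c_const (2 * j) l 0\<bar> * B_const j 0 *
            (\<Sum>k=1..N. K (\<lambda>x. W 1 x ^ (2 * j) * (\<Prod>p=1..k. (W (p + 1) x)\<^sup>2))))"
      by (intro sum_nonneg mult_nonneg_nonneg B_const_nonneg K_nonneg continuous_intros cW)
         (auto simp: power_mult intro!: prod_nonneg)
    ultimately have "A_const l 0 * K (\<lambda>x. 1) + B_const l 0 * (\<Sum>k=1..Suc N. K (\<lambda>x. \<Prod>p=1..k. (W p x)\<^sup>2))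
      < integral {a..b} (\<lambda>t. (norm (F l t))\<^sup>2)"
      unfolding R by linarith
    then show ?thesis
      unfolding K[symmetric] by simp
  qed
  then show ?thesis
    using c' cont unfolding halfline_hardy_def by blast
qed

subsection \<open>Test functions and the four weights\<close>

lemma nth_deriv_Suc: "nth_deriv (Suc k) f x = vector_derivative (nth_deriv k f) (at x)"
  by (simp add: nth_deriv_def)

lemma nth_deriv_eq_0_on_open:
  assumes "open U" "\<And>x. x \<in> U \<Longrightarrow> f x = 0" "x \<in> U"
  shows "nth_deriv k f x = 0"
  using assms(3)
proof (induction k arbitrary: x)
  case 0
  then show ?case using assms(2) by (simp add: nth_deriv_def)
next
  case (Suc k)
  have "(nth_deriv k f has_vector_derivative 0) (at x)"
    by (rule has_vector_derivative_transform_within_open[of "\<lambda>_. 0", OF _ assms(1) Suc.prems])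
       (use Suc.IH in auto)
  then show ?case
    by (simp add: nth_deriv_Suc vector_derivative_at)
qed

text \<open>The derivatives are extended by zero: a point outside \<open>S\<close> lies in the open
  complement of the support, where everything vanishes. Connectedness keeps the interval spanned by
  the support inside \<open>S\<close>.\<close>

lemma test_function_chain:
  fixes f :: "real \<Rightarrow> 'a::real_normed_vector"
  assumes f: "f \<in> test_functions S" and S: "open S" "connected S" "S \<noteq> {}"
  obtains a b and F :: "nat \<Rightarrow> real \<Rightarrow> 'a"
  where "smooth_chain a b F" "{a..b} \<subseteq> S" "a \<in> S" "\<And>k x. x \<in> S \<Longrightarrow> F k x = nth_deriv k f x"
proof -
  define K where "K = closure {x\<in>S. f x \<noteq> 0}"
  have K: "compact K" "K \<subseteq> S"
    and diff: "\<And>k x. x \<in> S \<Longrightarrow> nth_deriv k f differentiable (at x)"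
    using f by (auto simp: test_functions_def K_def)
  define F where "F k x = (if x \<in> S then nth_deriv k f x else 0)" for k x
  have op: "open (- K)"
    using K by (simp add: open_closed compact_imp_closed)
  have F0: "F k x = 0" if "x \<notin> K" for k x
  proof (cases "x \<in> S")
    case True
    have "open (S - K)"
      using op S by (simp add: Diff_eq open_Int)
    moreover have "f y = 0" if "y \<in> S - K" for y
      using that closure_subset[of "{x\<in>S. f x \<noteq> 0}"] by (auto simp: K_def)
    ultimately have "nth_deriv k f x = 0"
      by (rule nth_deriv_eq_0_on_open) (use True that in auto)
    then show ?thesis by (simp add: F_def)
  qed (simp add: F_def)
  have deriv: "(F k has_vector_derivative F (Suc k) x) (at x)" for k x
  proof (cases "x \<in> S")
    case True
    have "(nth_deriv k f has_vector_derivative F (Suc k) x) (at x)"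
      using diff[OF True, of k] True by (simp add: F_def nth_deriv_Suc vector_derivative_works)
    then show ?thesis
      by (rule has_vector_derivative_transform_within_open[OF _ S(1) True]) (simp add: F_def)
  next
    case False
    then have x: "x \<in> - K" using K by auto
    have "((\<lambda>_. 0) has_vector_derivative F (Suc k) x) (at x)"
      using F0 x by simp
    then show ?thesis
      by (rule has_vector_derivative_transform_within_open[OF _ op x]) (simp add: F0)
  qed
  \<comment> \<open>The endpoints lie in \<open>S\<close> even when the support is empty, so that
    \<open>0 < a\<close> can be inferred later.\<close>
  obtain a b where ab: "K \<subseteq> {a..b}" "a \<in> S" "b \<in> S"
  proof (cases "K = {}")
    case True
    then show ?thesis using that S by blast
  next
    case False
    then obtain a b where "a \<in> K" "b \<in> K" "\<And>x. x \<in> K \<Longrightarrow> a \<le> x" "\<And>x. x \<in> K \<Longrightarrow> x \<le> b"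
      using compact_attains_inf[OF K(1) False] compact_attains_sup[OF K(1) False] by metis
    then show ?thesis using that[of a b] K(2) by (meson atLeastAtMost_iff subset_iff)
  qed
  show thesis
  proof (rule that[of a b F])
    show "smooth_chain a b F"
      using deriv F0 ab(1) unfolding smooth_chain_def by blast
    show "{a..b} \<subseteq> S"
      by (rule connected_contains_Icc[OF S(2) ab(2,3)])
  qed (use ab in \<open>auto simp: F_def\<close>)
qed

text \<open>The integrand lives on a compact interval away from 0 and is continuous there, so the
  Lebesgue integral agrees with the gauge integral used so far.\<close>

lemma weighted_int_eq_integral:
  assumes sub: "{a..b} \<subseteq> S" and a: "0 < a"
    and eq: "\<And>x. x \<in> S \<Longrightarrow> g x = G x" and out: "\<And>x. x \<notin> {a..b} \<Longrightarrow> G x = 0"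
    and cont: "continuous_on {a..b} w" "continuous_on {a..b} G"
  shows "weighted_int S \<beta> w g = integral {a..b} (\<lambda>x. x powr \<beta> * w x * (norm (G x))\<^sup>2)"
proof -
  have "weighted_int S \<beta> w g = (LBINT x:{a..b}. x powr \<beta> * w x * (norm (G x))\<^sup>2)"
    unfolding weighted_int_def set_lebesgue_integral_def
    by (rule Bochner_Integration.integral_cong) (use sub eq out in \<open>auto simp: indicator_def\<close>)
  also have "\<dots> = integral {a..b} (\<lambda>x. x powr \<beta> * w x * (norm (G x))\<^sup>2)"
    using a by (intro set_borel_integral_eq_integral(2) borel_integrable_atLeastAtMost'
        continuous_intros cont) auto
  finally show ?thesis .
qed

text \<open>The chain is restarted at the derivative of order \<open>m - l\<close>, so that its
  \<open>l\<close>-th member is the derivative of order \<open>m\<close>. The zero function is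
  treated apart because \<open>log_hardy_ineq\<close> is strict.\<close>

lemma hardy_ineq_log_weights:
  fixes f :: "real \<Rightarrow> 'a::complex_inner_space"
  assumes hh: "halfline_hardy TYPE('a) N c W'"
    and S: "open S" "connected S" "S \<noteq> {}" "S \<subseteq> {0<..}" and s: "s = 1 \<or> s = -1"
    and \<tau>: "\<And>x. x \<in> S \<Longrightarrow> c < s * ln x + d"
    and W1: "\<And>x. x \<in> S \<Longrightarrow> W 1 x = inverse (s * ln x + d)"
    and WS: "\<And>p x. 1 \<le> p \<Longrightarrow> p \<le> N \<Longrightarrow> x \<in> S \<Longrightarrow> W (Suc p) x = W' p (s * ln x + d)"
    and l: "1 \<le> l" "l \<le> m" and f: "f \<in> test_functions S"
  shows "hardy_ineq S l m (Suc N) \<alpha> W f"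
proof -
  obtain a b and F :: "nat \<Rightarrow> real \<Rightarrow> 'a" where F: "smooth_chain a b F"
    and ab: "{a..b} \<subseteq> S" "a \<in> S" and eq: "\<And>k x. x \<in> S \<Longrightarrow> F k x = nth_deriv k f x"
    using test_function_chain[OF f S(1-3)] by blast
  have f0: "f x = F 0 x" if "x \<in> S" for x
    using eq[OF that, of 0] by (simp add: nth_deriv_def)
  have a: "0 < a" using ab S by auto
  show ?thesis
  proof (cases "\<exists>x\<in>S. f x \<noteq> 0")
    case False
    have "F 0 x = 0" for x
      using False f0[of x] smooth_chain_outside[OF F, of x 0] ab(1) by (cases "x \<in> S") (simp, blast)
    then have "nth_deriv k f x = 0" if "x \<in> S" for k x
      using smooth_chain_zero_up[OF F] eq[OF that] by metis
    then have "weighted_int S \<beta> w (nth_deriv k f) = 0" for \<beta> w k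
      unfolding weighted_int_def set_lebesgue_integral_def
      by (intro Bochner_Integration.integral_eq_zero_AE AE_I2) (auto simp: indicator_def)
    then show ?thesis
      using False by (simp add: hardy_ineq_def log_terms_def)
  next
    case True
    define G where "G k = F (k + (m - l))" for k
    have G: "smooth_chain a b G"
      unfolding G_def by (rule smooth_chain_shift[OF F])
    \<comment> \<open>Strictness is claimed for nonzero \<open>f\<close>, while a nonzero derivative
      of order \<open>m - l\<close> is required; the bounded support bridges the gap.\<close>
    have "\<exists>x. G 0 x \<noteq> 0"
      using smooth_chain_zero_down[OF F, of "m - l"] True f0 by (auto simp: G_def)
    then obtain x0 where nz: "G 0 x0 \<noteq> 0" ..
    have cW: "continuous_on {a..b} (W p)" if "p \<in> {1..Suc N}" for p
      by (rule continuous_on_log_weight[OF hh _ \<tau> W1 WS that]) (use ab S in auto)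
    define K where "K w = integral {a..b} (\<lambda>x. x powr (\<alpha> - 2 * real l) * w x * (norm (G 0 x))\<^sup>2)" for w
    have K: "weighted_int S (\<alpha> - 2 * real l) w (nth_deriv (m - l) f) = K w" if "continuous_on {a..b} w" for w
      unfolding K_def
      by (rule weighted_int_eq_integral[OF ab(1) a _ smooth_chain_outside[OF G] that
            smooth_chain_continuous[OF G]]) (simp_all add: G_def eq)
    have lhs: "weighted_int S \<alpha> (\<lambda>x. 1) (nth_deriv m f) = integral {a..b} (\<lambda>x. x powr \<alpha> * 1 * (norm (G l x))\<^sup>2)"
      by (rule weighted_int_eq_integral[OF ab(1) a _ smooth_chain_outside[OF G] continuous_on_const
            smooth_chain_continuous[OF G]]) (use l in \<open>simp_all add: G_def eq\<close>)
    have K1: "weighted_int S (\<alpha> - 2 * real l) (\<lambda>x. \<Prod>p=1..k. (W p x)\<^sup>2) (nth_deriv (m - l) f) =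
        K (\<lambda>x. \<Prod>p=1..k. (W p x)\<^sup>2)" if "k \<in> {1..Suc N}" for k
      using that by (intro K continuous_intros cW) auto
    have K2: "weighted_int S (\<alpha> - 2 * real l) (\<lambda>x. W 1 x ^ (2 * j)) (nth_deriv (m - l) f) =
        K (\<lambda>x. W 1 x ^ (2 * j))" for j
      by (intro K continuous_intros cW) auto
    have K3: "weighted_int S (\<alpha> - 2 * real l) (\<lambda>x. W 1 x ^ (2 * j) * (\<Prod>p=1..k. (W (p + 1) x)\<^sup>2))
          (nth_deriv (m - l) f) =
        K (\<lambda>x. W 1 x ^ (2 * j) * (\<Prod>p=1..k. (W (p + 1) x)\<^sup>2))" if "k \<in> {1..N}" for j k
      using that by (intro K continuous_intros cW) auto
    have "A_const l \<alpha> * K (\<lambda>x. 1)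
     + (B_const l \<alpha> * (\<Sum>k=1..Suc N. K (\<lambda>x. \<Prod>p=1..k. (W p x)\<^sup>2))
       + (\<Sum>j=2..l. \<bar>c_const (2 * j) l \<alpha>\<bar> * A_const j 0 * K (\<lambda>x. W 1 x ^ (2 * j)))
       + (\<Sum>j=2..l. \<bar>c_const (2 * j) l \<alpha>\<bar> * B_const j 0 *
            (\<Sum>k=1..N. K (\<lambda>x. W 1 x ^ (2 * j) * (\<Prod>p=1..k. (W (p + 1) x)\<^sup>2)))))
      < integral {a..b} (\<lambda>x. x powr \<alpha> * 1 * (norm (G l x))\<^sup>2)"
      unfolding K_def
      by (rule log_hardy_ineq[OF hh G nz a s l(1)]) (use ab \<tau> W1 WS in auto)
    moreover have "log_terms S l (Suc N) \<alpha> W (nth_deriv (m - l) f) =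
       B_const l \<alpha> * (\<Sum>k=1..Suc N. K (\<lambda>x. \<Prod>p=1..k. (W p x)\<^sup>2))
       + (\<Sum>j=2..l. \<bar>c_const (2 * j) l \<alpha>\<bar> * A_const j 0 * K (\<lambda>x. W 1 x ^ (2 * j)))
       + (\<Sum>j=2..l. \<bar>c_const (2 * j) l \<alpha>\<bar> * B_const j 0 *
            (\<Sum>k=1..N. K (\<lambda>x. W 1 x ^ (2 * j) * (\<Prod>p=1..k. (W (p + 1) x)\<^sup>2))))"
      unfolding log_terms_def K2 diff_Suc_1
      by (intro arg_cong2[where f = "(+)"] arg_cong2[where f = "(*)"] sum.cong refl K1 K3)
    ultimately show ?thesis
      unfolding hardy_ineq_def Let_def lhs by (simp add: K)
  qed
qed

section \<open>Iterated exponentials and logarithms as half-line weights\<close>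

lemma iter_exp_Suc: "iter_exp (Suc n) = exp (iter_exp n)"
  by (simp add: iter_exp_def)

lemma iter_exp_nonneg: "0 \<le> iter_exp n"
  by (cases n) (simp_all add: iter_exp_def)

lemma iter_ln_Suc: "iter_ln (Suc p) x = iter_ln p (ln x)"
  by (simp add: iter_ln_def funpow_Suc_right del: funpow.simps)

lemma iter_ln_0: "iter_ln 0 x = x"
  by (simp add: iter_ln_def)

lemma norm_iter_ln_Suc: "norm_iter_ln (Suc p) x = norm_iter_ln p (inverse (1 - ln x))"
  by (simp add: norm_iter_ln_def funpow_Suc_right del: funpow.simps)

lemma norm_iter_ln_0: "norm_iter_ln 0 x = x"
  by (simp add: norm_iter_ln_def)

text \<open>The logarithm maps the half-line beyond \<open>iter_exp (Suc N)\<close> into the one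
  beyond \<open>iter_exp N\<close> and lowers the index of each iterated logarithm by one.\<close>

lemma halfline_hardy_iter_ln:
  "halfline_hardy TYPE('a::complex_inner_space) N (iter_exp N) (\<lambda>p x. inverse (iter_ln p x))"
proof (induction N)
  case 0
  then show ?case by (rule halfline_hardy_base[OF iter_exp_nonneg])
next
  case (Suc N)
  show ?case
  proof (rule halfline_hardy_step[OF Suc iter_exp_nonneg, where d = 0])
    fix x assume "iter_exp (Suc N) < x"
    then show "iter_exp N < ln x + 0"
      by (metis add_0_right exp_gt_zero exp_less_cancel_iff exp_ln iter_exp_Suc less_trans)
  qed (simp_all add: iter_ln_Suc iter_ln_0)
qed

text \<open>With t = 1 + ln x, the first weight is 1 / t and
  \<open>norm_iter_ln (Suc p) (1 / x)\<close> is \<open>norm_iter_ln p (1 / t)\<close>. This map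
  sends the half-line beyond 1 into itself, so the threshold does not grow with
  \<open>N\<close>.\<close>

lemma halfline_hardy_norm_iter_ln:
  "halfline_hardy TYPE('a::complex_inner_space) N 1 (\<lambda>p x. norm_iter_ln p (1 / x))"
proof (induction N)
  case 0
  then show ?case by (rule halfline_hardy_base) simp
next
  case (Suc N)
  show ?case
    by (rule halfline_hardy_step[OF Suc, where d = 1])
       (simp_all add: norm_iter_ln_Suc norm_iter_ln_0 ln_div inverse_eq_divide add.commute)
qed

section \<open>Exceptional parameters and the four inequalities\<close>

lemma A_const_eq_0_iff: "A_const l \<alpha> = 0 \<longleftrightarrow> (\<exists>j\<in>{1..l}. \<alpha> = 2 * real j - 1)"
  by (auto simp: A_const_def)

lemma hardy_ineq_without_A:
  "A_const l \<alpha> = 0 \<Longrightarrow> hardy_ineq S l m N \<alpha> W f \<Longrightarrow> hardy_ineq_without_A S l m N \<alpha> W f"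
  by (simp add: hardy_ineq_def hardy_ineq_without_A_def)

text \<open>Here t = ln (x / \<gamma>). The change of variables supplies one of the \<open>N\<close>
  logarithms, so the half-line inequality is used with \<open>N - 1\<close> of them.\<close>

lemma hardy_outer_ln:
  fixes f :: "real \<Rightarrow> 'h::complex_inner_space"
  assumes l: "1 \<le> l" "l \<le> m" and N: "1 \<le> N" and pos: "0 < \<rho>" "0 < \<gamma>"
    and \<rho>: "iter_exp N * \<gamma> \<le> \<rho>" and f: "f \<in> test_functions {\<rho><..}"
  shows "hardy_ineq {\<rho><..} l m N \<alpha> (\<lambda>p x. inverse (iter_ln p (x / \<gamma>))) f"
proof -
  obtain n where n: "N = Suc n" using N by (cases N) auto
  have *: "iter_exp n < 1 * ln x + - ln \<gamma>" if "x \<in> {\<rho><..}" for x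
  proof -
    have x: "x > 0" "exp (iter_exp n) < x / \<gamma>"
      using that pos \<rho> by (simp_all add: n iter_exp_Suc pos_less_divide_eq)
    then have "iter_exp n < ln (x / \<gamma>)"
      by (metis exp_gt_zero exp_less_cancel_iff exp_ln less_trans)
    then show ?thesis using x pos by (simp add: ln_div)
  qed
  show ?thesis
    unfolding n
    by (rule hardy_ineq_log_weights[OF halfline_hardy_iter_ln _ _ _ _ _ * _ _ l f])
       (use pos in \<open>auto simp: iter_ln_Suc iter_ln_0 ln_div\<close>)
qed

text \<open>Here t = ln (\<gamma> / x), with s = -1, sends the bounded interval into the half-line
  beyond \<open>iter_exp (N - 1)\<close>.\<close>

lemma hardy_inner_ln:
  fixes f :: "real \<Rightarrow> 'h::complex_inner_space"
  assumes l: "1 \<le> l" "l \<le> m" and N: "1 \<le> N" and pos: "0 < \<rho>" "0 < \<gamma>"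
    and \<rho>: "iter_exp N * \<rho> \<le> \<gamma>" and f: "f \<in> test_functions {0<..<\<rho>}"
  shows "hardy_ineq {0<..<\<rho>} l m N \<alpha> (\<lambda>p x. inverse (iter_ln p (\<gamma> / x))) f"
proof -
  obtain n where n: "N = Suc n" using N by (cases N) auto
  have *: "iter_exp n < -1 * ln x + ln \<gamma>" if "x \<in> {0<..<\<rho>}" for x
  proof -
    have "exp (iter_exp n) * x < exp (iter_exp n) * \<rho>"
      using that by simp
    then have "exp (iter_exp n) * x < \<gamma>"
      using \<rho> by (simp only: n iter_exp_Suc)
    then have x: "x > 0" "exp (iter_exp n) < \<gamma> / x"
      using that pos \<rho> by (simp_all add: n iter_exp_Suc pos_less_divide_eq)
    then have "iter_exp n < ln (\<gamma> / x)"
      by (metis exp_gt_zero exp_less_cancel_iff exp_ln less_trans)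
    then show ?thesis using x pos by (simp add: ln_div)
  qed
  show ?thesis
    unfolding n
    by (rule hardy_ineq_log_weights[OF halfline_hardy_iter_ln _ _ _ _ _ * _ _ l f])
       (use pos in \<open>auto simp: iter_ln_Suc iter_ln_0 ln_div\<close>)
qed

text \<open>With t = 1 - ln (\<tau> / x) the first weight is 1 / t, and \<tau> \<le> \<rho> < x
  gives t > 1.\<close>

lemma hardy_outer_norm_iter_ln:
  fixes f :: "real \<Rightarrow> 'h::complex_inner_space"
  assumes l: "1 \<le> l" "l \<le> m" and N: "1 \<le> N" and pos: "0 < \<rho>" "0 < \<tau>"
    and \<rho>: "\<tau> \<le> \<rho>" and f: "f \<in> test_functions {\<rho><..}"
  shows "hardy_ineq {\<rho><..} l m N \<alpha> (\<lambda>p x. norm_iter_ln p (\<tau> / x)) f"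
proof -
  obtain n where n: "N = Suc n" using N by (cases N) auto
  have *: "1 < 1 * ln x + (1 - ln \<tau>)" if "x \<in> {\<rho><..}" for x
    using that pos \<rho> by simp
  show ?thesis
    unfolding n
    by (rule hardy_ineq_log_weights[OF halfline_hardy_norm_iter_ln _ _ _ _ _ * _ _ l f])
       (use pos in \<open>auto simp: norm_iter_ln_Suc norm_iter_ln_0 ln_div inverse_eq_divide algebra_simps\<close>)
qed

text \<open>With t = 1 - ln (x / \<tau>), so s = -1, the bound x < \<rho> \<le> \<tau> gives t >
  1.\<close>

lemma hardy_inner_norm_iter_ln:
  fixes f :: "real \<Rightarrow> 'h::complex_inner_space"
  assumes l: "1 \<le> l" "l \<le> m" and N: "1 \<le> N" and pos: "0 < \<rho>" "0 < \<tau>"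
    and \<rho>: "\<rho> \<le> \<tau>" and f: "f \<in> test_functions {0<..<\<rho>}"
  shows "hardy_ineq {0<..<\<rho>} l m N \<alpha> (\<lambda>p x. norm_iter_ln p (x / \<tau>)) f"
proof -
  obtain n where n: "N = Suc n" using N by (cases N) auto
  have *: "1 < -1 * ln x + (1 + ln \<tau>)" if "x \<in> {0<..<\<rho>}" for x
    using that pos \<rho> by simp
  show ?thesis
    unfolding n
    by (rule hardy_ineq_log_weights[OF halfline_hardy_norm_iter_ln _ _ _ _ _ * _ _ l f])
       (use pos in \<open>auto simp: norm_iter_ln_Suc norm_iter_ln_0 ln_div inverse_eq_divide algebra_simps\<close>)
qed

theorem theorem4p2:
  fixes l m N :: nat and \<alpha> \<rho> \<gamma> \<tau> :: real
  assumes separable: "\<exists>D :: 'h::complex_hilbert_space set. countable D \<and> closure D = UNIV"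
    and "1 \<le> l" and "l \<le> m" and "1 \<le> N"
    and "0 < \<rho>" and "0 < \<gamma>" and "0 < \<tau>"
  shows "
    (\<rho> \<ge> iter_exp N * \<gamma> \<longrightarrow>
       (\<forall>f \<in> (test_functions {\<rho><..} :: (real \<Rightarrow> 'h) set).
          hardy_ineq {\<rho><..} l m N \<alpha> (\<lambda>p x. inverse (iter_ln p (x / \<gamma>))) f)) \<and>
    (\<rho> \<ge> \<tau> \<longrightarrow>
       (\<forall>f \<in> (test_functions {\<rho><..} :: (real \<Rightarrow> 'h) set).
          hardy_ineq {\<rho><..} l m N \<alpha> (\<lambda>p x. norm_iter_ln p (\<tau> / x)) f)) \<and>
    (\<gamma> \<ge> iter_exp N * \<rho> \<longrightarrow>
       (\<forall>f \<in> (test_functions {0<..<\<rho>} :: (real \<Rightarrow> 'h) set).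
          hardy_ineq {0<..<\<rho>} l m N \<alpha> (\<lambda>p x. inverse (iter_ln p (\<gamma> / x))) f)) \<and>
    (\<tau> \<ge> \<rho> \<longrightarrow>
       (\<forall>f \<in> (test_functions {0<..<\<rho>} :: (real \<Rightarrow> 'h) set).
          hardy_ineq {0<..<\<rho>} l m N \<alpha> (\<lambda>p x. norm_iter_ln p (x / \<tau>)) f)) \<and>
    (A_const l \<alpha> = 0 \<longleftrightarrow> (\<exists>j\<in>{1..l}. \<alpha> = 2 * real j - 1)) \<and>
    ((\<exists>j\<in>{1..l}. \<alpha> = 2 * real j - 1) \<longrightarrow>
      (\<rho> \<ge> iter_exp N * \<gamma> \<longrightarrow>
         (\<forall>f \<in> (test_functions {\<rho><..} :: (real \<Rightarrow> 'h) set).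
            hardy_ineq_without_A {\<rho><..} l m N \<alpha> (\<lambda>p x. inverse (iter_ln p (x / \<gamma>))) f)) \<and>
      (\<rho> \<ge> \<tau> \<longrightarrow>
         (\<forall>f \<in> (test_functions {\<rho><..} :: (real \<Rightarrow> 'h) set).
            hardy_ineq_without_A {\<rho><..} l m N \<alpha> (\<lambda>p x. norm_iter_ln p (\<tau> / x)) f)) \<and>
      (\<gamma> \<ge> iter_exp N * \<rho> \<longrightarrow>
         (\<forall>f \<in> (test_functions {0<..<\<rho>} :: (real \<Rightarrow> 'h) set).
            hardy_ineq_without_A {0<..<\<rho>} l m N \<alpha> (\<lambda>p x. inverse (iter_ln p (\<gamma> / x))) f)) \<and>
      (\<tau> \<ge> \<rho> \<longrightarrow>
         (\<forall>f \<in> (test_functions {0<..<\<rho>} :: (real \<Rightarrow> 'h) set).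
            hardy_ineq_without_A {0<..<\<rho>} l m N \<alpha> (\<lambda>p x. norm_iter_ln p (x / \<tau>)) f)))"
  by (intro conjI impI ballI hardy_outer_ln hardy_inner_ln hardy_outer_norm_iter_ln
      hardy_inner_norm_iter_ln hardy_ineq_without_A A_const_eq_0_iff[THEN iffD2] A_const_eq_0_iff
      assms(2-); assumption)

end
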